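(* For every instance $(G,T,\ell)$ of the 0-Extension with Steiner Nodes problem with $|T|\le 5$, there exists a solution $(\mathcal{F},\delta)$ such that $|\mathcal{F}|\le 30$ and $\mathrm{vol}(\mathcal{F},\delta)\le \sum_{(u,v)\in E}c(u,v)\cdot \mathrm{dist}_\ell(u,v)$.
   Context: 0-Extension with Steiner Nodes: an instance $(G,T,\ell)$ consists of an undirected graph $G=(V,E,c)$ with positive edge capacities $c$, nonnegative edge lengths $\{\ell_e\}_{e\in E}$, and a set $T\subseteq V$ of terminals. Let $\mathrm{dist}_\ell$ denote the shortest-path distance in $G$ w.r.t. $\ell$. A solution is a pair $(\mathcal{F},\delta)$ where $\mathcal{F}$ is a partition of $V$ such that distinct terminals lie in distinct parts (for $u\in V$, $F(u)$ denotes the part containing $u$), and $\delta$ is a semi-metric on the parts of $\mathcal{F}$ such that $\delta(F(t),F(t'))=\mathrm{dist}_\ell(t,t')$ for all $t,t'\in T$. Its cost is $\mathrm{vol}(\mathcal{F},\delta)=\sum_{(u,v)\in E}c(u,v)\cdot\delta(F(u),F(v))$ and its size is $|\mathcal{F}|$. *)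

theory Defs
  imports Complex_Main "HOL-Library.Disjoint_Sets"
begin

text \<open>An undirected edge is a two-element set of vertices.\<close>

fun walk :: "'v set \<Rightarrow> 'v set set \<Rightarrow> 'v list \<Rightarrow> bool" where
  "walk V E [] \<longleftrightarrow> False"
| "walk V E [u] \<longleftrightarrow> u \<in> V"
| "walk V E (u # v # p) \<longleftrightarrow> u \<in> V \<and> {u, v} \<in> E \<and> walk V E (v # p)"

fun walk_length :: "('v set \<Rightarrow> real) \<Rightarrow> 'v list \<Rightarrow> real" where
  "walk_length l (u # v # p) = l {u, v} + walk_length l (v # p)"
| "walk_length l _ = 0"

definition walks_between :: "'v set \<Rightarrow> 'v set set \<Rightarrow> 'v \<Rightarrow> 'v \<Rightarrow> 'v list set" where
  "walks_between V E u v = {p. walk V E p \<and> hd p = u \<and> last p = v}"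

text \<open>Meaningful only if some walk joins the two vertices; below it is only used for
  the endpoints of an edge and for pairs of terminals, where this is the case.\<close>

definition sp_dist :: "'v set \<Rightarrow> 'v set set \<Rightarrow> ('v set \<Rightarrow> real) \<Rightarrow> 'v \<Rightarrow> 'v \<Rightarrow> real" where
  "sp_dist V E l u v = (INF p \<in> walks_between V E u v. walk_length l p)"

text \<open>The last conjunct says that \<open>sp_dist\<close> is finite on terminals; otherwise no
  real-valued semi-metric could agree with it there and there would be no solution.\<close>

definition zero_ext_instance ::
  "'v set \<Rightarrow> 'v set set \<Rightarrow> ('v set \<Rightarrow> real) \<Rightarrow> ('v set \<Rightarrow> real) \<Rightarrow> 'v set \<Rightarrow> bool" where
  "zero_ext_instance V E c l T \<longleftrightarrow>
     finite V \<and>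
     E \<subseteq> {{u, v} | u v. u \<in> V \<and> v \<in> V \<and> u \<noteq> v} \<and>
     (\<forall>e \<in> E. c e > 0) \<and>
     (\<forall>e \<in> E. l e \<ge> 0) \<and>
     T \<subseteq> V \<and>
     (\<forall>t \<in> T. \<forall>t' \<in> T. walks_between V E t t' \<noteq> {})"

definition semimetric_on :: "'a set \<Rightarrow> ('a \<Rightarrow> 'a \<Rightarrow> real) \<Rightarrow> bool" where
  "semimetric_on S d \<longleftrightarrow>
     (\<forall>x \<in> S. \<forall>y \<in> S. d x y \<ge> 0) \<and>
     (\<forall>x \<in> S. d x x = 0) \<and>
     (\<forall>x \<in> S. \<forall>y \<in> S. d x y = d y x) \<and>
     (\<forall>x \<in> S. \<forall>y \<in> S. \<forall>z \<in> S. d x z \<le> d x y + d y z)"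

definition part_of :: "'v set set \<Rightarrow> 'v \<Rightarrow> 'v set" where
  "part_of F u = (THE A. A \<in> F \<and> u \<in> A)"

definition zero_ext_solution ::
  "'v set \<Rightarrow> 'v set set \<Rightarrow> ('v set \<Rightarrow> real) \<Rightarrow> 'v set \<Rightarrow>
     'v set set \<Rightarrow> ('v set \<Rightarrow> 'v set \<Rightarrow> real) \<Rightarrow> bool" where
  "zero_ext_solution V E l T F \<delta> \<longleftrightarrow>
     partition_on V F \<and>
     (\<forall>t \<in> T. \<forall>t' \<in> T. t \<noteq> t' \<longrightarrow> part_of F t \<noteq> part_of F t') \<and>
     semimetric_on F \<delta> \<and>
     (\<forall>t \<in> T. \<forall>t' \<in> T. \<delta> (part_of F t) (part_of F t') = sp_dist V E l t t')"

text \<open>The value \<open>f u v\<close> for an unordered pair \<open>{u, v}\<close>; well defined when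
  \<open>f\<close> is symmetric on that pair.\<close>

definition on_edge :: "('v \<Rightarrow> 'v \<Rightarrow> real) \<Rightarrow> 'v set \<Rightarrow> real" where
  "on_edge f e = (THE x. \<exists>u v. e = {u, v} \<and> x = f u v)"

lemma on_edge_doubleton:
  assumes "f u v = f v u"
  shows "on_edge f {u, v} = f u v"
  unfolding on_edge_def using assms by (intro the_equality) (auto simp: doubleton_eq_iff)

definition vol ::
  "'v set set \<Rightarrow> ('v set \<Rightarrow> real) \<Rightarrow> 'v set set \<Rightarrow> ('v set \<Rightarrow> 'v set \<Rightarrow> real) \<Rightarrow> real" where
  "vol E c F \<delta> = (\<Sum>e \<in> E. c e * on_edge (\<lambda>u v. \<delta> (part_of F u) (part_of F v)) e)"

end

theory Submission
  imports Defs "HOL-Analysis.Analysis"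
begin

text \<open>
  Sending a vertex to its distances from the terminals, followed by a 1-Lipschitz retraction,
  maps the graph metric into the tight span of the terminal semimetric \<open>d\<close>. A split of at most two
  terminals against the rest that has positive isolation index contributes an interval coordinate on
  the tight span; subtracting the split from \<open>d\<close> contracts this coordinate and shortens distances by
  at least its variation. After the fifteen splits of five terminals are removed, the residual
  semimetric is a multiple \<open>\<beta>\<close> of the graph metric of the complete bipartite graph with parts \<open>{a, b}\<close>
  and the other three terminals, whose tight span consists of three triangles with a common
  hypotenuse.

  Every coordinate is rounded to an end of its interval by a threshold. Averaging over the threshold
  shows that a suitable choice does not increase the cost, and since the cost is additive the
  thresholds can be chosen one after the other. The rounded points are the five terminals and at most
  25 points described by the splits on whose small side they lie and a vertex of the bipartite
  graph: these sides intersect pairwise, and no three splits cross each other on a 4-set.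
\<close>

subsection \<open>Tight spans of finite semimetrics\<close>

text \<open>Each weight is an isolation index of the current residual, so facts about different
  stages have to be connected. Signs suffice: a nonpositive gap stays nonpositive under later
  removals, and a negative gap of four distinct points was already negative before the earlier ones.
  The first rule keeps a removed split exhausted and gives every split of positive weight positive
  gaps in \<open>d\<close>; the second lets the final bipartite graph restrict which pairs had
  positive weight. Singletons come first because a point below the upper end of such a split
  contracts to a terminal in all later stages, so it shares the label of that terminal. For the
  other points let \<open>B\<close> be the set of pairs of positive weight on whose side the point
  is rounded: it is empty, one pair, or two pairs with a common element. If \<beta> > 0, these pairs
  are edges of the bipartite graph and the chosen vertex lies on all of them, which gives at most 5
  + 6 * 2 + 5 = 22 labels; if \<beta> = 0, a constant vertex gives at most 1 + 10 + 5 = 16.\<close>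

lemma semimetric_onD:
  assumes "semimetric_on S d" "x \<in> S" "y \<in> S"
  shows "d x y \<ge> 0" "d x x = 0" "d x y = d y x" "z \<in> S \<Longrightarrow> d x z \<le> d x y + d y z"
  using assms unfolding semimetric_on_def by blast+

definition dominating :: "('i \<Rightarrow> 'i \<Rightarrow> real) \<Rightarrow> ('i \<Rightarrow> real) set" where
  "dominating d = {f. \<forall>i j. d i j \<le> f i + f j}"

definition tight_span :: "('i \<Rightarrow> 'i \<Rightarrow> real) \<Rightarrow> ('i \<Rightarrow> real) set" where
  "tight_span d = {f \<in> dominating d. \<forall>i. \<exists>j. f i + f j = d i j}"

text \<open>Neither coordinate of a tight pair can be lowered. This is why the retraction below
  fixes the rows of \<open>d\<close>, which represent the terminals.\<close>

lemma tight_span_minimal: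
  assumes "f \<in> tight_span d" "g \<in> dominating d" "\<And>i. g i \<le> f i"
  shows "g = f"
proof
  fix i
  obtain j where "f i + f j = d i j" using assms(1) by (auto simp: tight_span_def)
  moreover have "d i j \<le> g i + g j" using assms(2) by (auto simp: dominating_def)
  ultimately show "g i = f i" using assms(3)[of i] assms(3)[of j] by linarith
qed

lemma row_in_tight_span:
  assumes "semimetric_on UNIV d" shows "d t \<in> tight_span d"
proof -
  have "d i j \<le> d t i + d t j" for i j
    using semimetric_onD(4)[OF assms, of i t j] semimetric_onD(3)[OF assms, of i t] by simp
  moreover have "d t i + d t t = d i t" for i
    using semimetric_onD(2,3)[OF assms, of t i] by simp
  ultimately show ?thesis unfolding tight_span_def dominating_def by blast
qed

lemma tight_span_lipschitz:
  assumes "semimetric_on UNIV d" "f \<in> tight_span d"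
  shows "f i \<le> f j + d i j"
proof -
  obtain k where "f i + f k = d i k" using assms(2) by (auto simp: tight_span_def)
  moreover have "d j k \<le> f j + f k" using assms(2) by (auto simp: tight_span_def dominating_def)
  ultimately show ?thesis using semimetric_onD(4)[OF assms(1), of i j k] by simp
qed

text \<open>Domination bounds \<open>f i\<close> from below by \<open>d p i\<close>, the Lipschitz
  property from above.\<close>

lemma tight_span_eq_row:
  assumes "semimetric_on UNIV d" "f \<in> tight_span d" "f p = 0"
  shows "f = d p"
proof
  fix i
  have "d p i \<le> f p + f i" using assms(2) by (auto simp: tight_span_def dominating_def)
  with tight_span_lipschitz[OF assms(1,2), of i p] show "f i = d p i"
    using semimetric_onD(3)[OF assms(1), of i p] assms(3) by simp
qed

text \<open>Lowering one coordinate at a time to its smallest feasible value is 1-Lipschitz for the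
  maximum norm, and it never destroys a tight pair, because a coordinate in a tight pair
  cannot be lowered.\<close>

lemma tight_span_retraction:
  fixes d :: "'i::finite \<Rightarrow> 'i \<Rightarrow> real"
  assumes d: "semimetric_on UNIV d"
  shows "\<exists>\<rho>. \<forall>f\<in>dominating d. \<rho> f \<in> tight_span d \<and> (\<forall>i. \<rho> f i \<le> f i) \<and>
    (\<forall>g\<in>dominating d. \<forall>M. (\<forall>j. \<bar>f j - g j\<bar> \<le> M) \<longrightarrow> (\<forall>i. \<bar>\<rho> f i - \<rho> g i\<bar> \<le> M))"
proof -
  have sym: "d i j = d j i" and zero: "d i i = 0" for i j
    using semimetric_onD[OF d] by auto
  define P where "P A \<rho> \<longleftrightarrow> (\<forall>f\<in>dominating d. \<rho> f \<in> dominating d \<and> (\<forall>i. \<rho> f i \<le> f i)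
      \<and> (\<forall>i\<in>A. \<exists>j. \<rho> f i + \<rho> f j = d i j)
      \<and> (\<forall>g\<in>dominating d. \<forall>M. (\<forall>j. \<bar>f j - g j\<bar> \<le> M) \<longrightarrow> (\<forall>i. \<bar>\<rho> f i - \<rho> g i\<bar> \<le> M)))" for A \<rho>
  have "\<exists>\<rho>. P A \<rho>" if "finite A" for A
    using that
  proof induction
    case empty
    have "P {} (\<lambda>f. f)" by (auto simp: P_def)
    then show ?case by blast
  next
    case (insert a A)
    then obtain \<rho> where \<rho>: "P A \<rho>" by blast
    \<comment> \<open>The entry 0 is the bound from the pair of \<open>a\<close> with itself, as
      \<open>d a a = 0\<close>; the other entries come from the pairs with
      \<open>j \<noteq> a\<close>.\<close>
    define low where "low f = Max (insert 0 ((\<lambda>j. d a j - f j) ` (- {a})))" for f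
    have low_ge: "0 \<le> low f" "j \<noteq> a \<Longrightarrow> d a j - f j \<le> low f" for f j
      by (auto simp: low_def)
    have low_cases: "low f = 0 \<or> (\<exists>j. j \<noteq> a \<and> low f = d a j - f j)" for f
      using Max_in[of "insert 0 ((\<lambda>j. d a j - f j) ` (- {a}))"] by (auto simp: low_def)
    define \<sigma> where "\<sigma> f = (\<rho> f)(a := low (\<rho> f))" for f
    have "P (insert a A) \<sigma>" unfolding P_def
    proof (intro ballI conjI allI impI)
      fix f assume f: "f \<in> dominating d"
      define g where "g = \<rho> f"
      have g: "g \<in> dominating d" "\<And>i. g i \<le> f i" "\<And>i. i \<in> A \<Longrightarrow> \<exists>j. g i + g j = d i j"
        using \<rho> f by (auto simp: P_def g_def)
      have dom: "d i j \<le> g i + g j" for i j using g(1) by (auto simp: dominating_def)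
      have low_le: "low g \<le> g a"
        using low_cases[of g]
      proof (elim disjE exE conjE)
        assume "low g = 0" then show ?thesis using dom[of a a] zero[of a] by simp
      next
        fix j assume "low g = d a j - g j" then show ?thesis using dom[of a j] by simp
      qed
      have \<sigma>f: "\<sigma> f = g(a := low g)" by (simp add: \<sigma>_def g_def)
      have "d i j \<le> \<sigma> f i + \<sigma> f j" for i j
        using dom[of i j] low_ge(1)[of g] low_ge(2)[of i g] low_ge(2)[of j g] zero[of a] sym[of a i]
        by (cases "i = a"; cases "j = a") (auto simp: \<sigma>f)
      then show "\<sigma> f \<in> dominating d" by (simp add: dominating_def)
      show "\<sigma> f i \<le> f i" for i using g(2)[of i] g(2)[of a] low_le by (auto simp: \<sigma>f)
      show "\<exists>j. \<sigma> f i + \<sigma> f j = d i j" if i: "i \<in> insert a A" for i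
      proof (cases "i = a")
        case True
        from low_cases[of g] show ?thesis
        proof (elim disjE exE conjE)
          assume "low g = 0"
          then show ?thesis using True zero[of a] by (intro exI[of _ a]) (simp add: \<sigma>f)
        next
          fix j assume "j \<noteq> a" "low g = d a j - g j"
          then show ?thesis using True by (intro exI[of _ j]) (simp add: \<sigma>f)
        qed
      next
        case False
        then obtain j where j: "g i + g j = d i j" using i g(3) by auto
        have "low g = g a" if "j = a"
          using that j low_ge(2)[of i g] False low_le sym[of i a] by simp
        then have "\<sigma> f i + \<sigma> f j = d i j" using j False by (auto simp: \<sigma>f)
        then show ?thesis ..
      qed
      fix h M i assume h: "h \<in> dominating d" and M: "\<forall>j. \<bar>f j - h j\<bar> \<le> M"
      have le: "\<bar>g j - \<rho> h j\<bar> \<le> M" for j using \<rho> f h M by (auto simp: P_def g_def)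
      have aux: "low u \<le> low w + M" if "\<And>j. \<bar>u j - w j\<bar> \<le> M" for u w
        using low_cases[of u]
      proof (elim disjE exE conjE)
        assume "low u = 0" then show ?thesis using low_ge(1)[of w] that[of a] by simp
      next
        fix j assume "j \<noteq> a" "low u = d a j - u j"
        then show ?thesis using low_ge(2)[of j w] that[of j] by linarith
      qed
      have "\<bar>low g - low (\<rho> h)\<bar> \<le> M"
        using aux[of g "\<rho> h", OF le] aux[of "\<rho> h" g] le by (simp add: abs_minus_commute abs_le_iff)
      then show "\<bar>\<sigma> f i - \<sigma> h i\<bar> \<le> M" using le[of i] by (auto simp: \<sigma>f \<sigma>_def g_def)
    qed
    then show ?case by blast
  qed
  from this[OF finite] obtain \<rho> where "P UNIV \<rho>" by (rule exE)
  then show ?thesis unfolding P_def tight_span_def by (intro exI[of _ \<rho>]) simp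
qed

subsection \<open>Removing a split\<close>

text \<open>A pair \<open>(p, q)\<close> stands for the split \<open>{p, q}\<close> against its complement;
  \<open>p = q\<close> gives the splits with a singleton side.\<close>

definition separates :: "'i \<times> 'i \<Rightarrow> 'i \<Rightarrow> 'i \<Rightarrow> bool" where
  "separates S i j \<longleftrightarrow> (i \<in> {fst S, snd S}) \<noteq> (j \<in> {fst S, snd S})"

text \<open>A split has only positive gaps, by the four-point condition of Bandelt and Dress.
  Repeated points are allowed: \<open>gap d p p i j\<close> is twice a Gromov product. In a
  semimetric it is at least \<open>gap d p q i j\<close>, so testing the pair \<open>p, q\<close>
  also covers the pairs \<open>p, p\<close> and \<open>q, q\<close>.\<close>

definition gap :: "('i \<Rightarrow> 'i \<Rightarrow> real) \<Rightarrow> 'i \<Rightarrow> 'i \<Rightarrow> 'i \<Rightarrow> 'i \<Rightarrow> real" where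
  "gap d p q i j = max (d p i + d q j) (d p j + d q i) - d p q - d i j"

text \<open>The isolation index of Bandelt and Dress, truncated at 0.\<close>

definition isolation :: "('i::finite \<Rightarrow> 'i \<Rightarrow> real) \<Rightarrow> 'i \<times> 'i \<Rightarrow> real" where
  "isolation d S = max 0 (Min ((\<lambda>(i, j). gap d (fst S) (snd S) i j) `
      ((- {fst S, snd S}) \<times> (- {fst S, snd S}))) / 2)"

definition remove_split :: "('i::finite \<Rightarrow> 'i \<Rightarrow> real) \<Rightarrow> 'i \<times> 'i \<Rightarrow> 'i \<Rightarrow> 'i \<Rightarrow> real" where
  "remove_split d S i j = d i j - (if separates S i j then isolation d S else 0)"

text \<open>Position on the interval of the split, measured from its small side: half the excess of
  \<open>f\<close> at the two members of that side, cut off at the length of the interval.\<close>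

definition split_coord :: "('i::finite \<Rightarrow> 'i \<Rightarrow> real) \<Rightarrow> 'i \<times> 'i \<Rightarrow> ('i \<Rightarrow> real) \<Rightarrow> real" where
  "split_coord d S f = min (isolation d S) ((f (fst S) + f (snd S) - d (fst S) (snd S)) / 2)"

text \<open>Each \<open>f i\<close> loses the part of the distance to \<open>i\<close> that runs
  inside the interval, from the position of \<open>f\<close> to the end on which \<open>i\<close>
  lies.\<close>

definition contract_split :: "('i::finite \<Rightarrow> 'i \<Rightarrow> real) \<Rightarrow> 'i \<times> 'i \<Rightarrow> ('i \<Rightarrow> real) \<Rightarrow> 'i \<Rightarrow> real" where
  "contract_split d S f i = f i -
     (if i \<in> {fst S, snd S} then split_coord d S f else isolation d S - split_coord d S f)"

lemma isolation_nonneg: "0 \<le> isolation d S"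
  by (simp add: isolation_def)

lemma isolation_le_gap:
  assumes "isolation d S > 0" "i \<notin> {fst S, snd S}" "j \<notin> {fst S, snd S}"
  shows "2 * isolation d S \<le> gap d (fst S) (snd S) i j"
proof -
  let ?G = "(\<lambda>(i, j). gap d (fst S) (snd S) i j) ` ((- {fst S, snd S}) \<times> (- {fst S, snd S}))"
  have "Min ?G \<le> gap d (fst S) (snd S) i j"
    using assms(2,3) by (intro Min_le) (auto intro!: image_eqI[of _ _ "(i, j)"])
  moreover have "2 * isolation d S = Min ?G" using assms(1) by (auto simp: isolation_def)
  ultimately show ?thesis by simp
qed

lemma isolation_attained:
  assumes "- {fst S, snd S} \<noteq> {}"
  obtains i j where "i \<notin> {fst S, snd S}" "j \<notin> {fst S, snd S}"
    "gap d (fst S) (snd S) i j \<le> 2 * isolation d S"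
proof -
  let ?G = "(\<lambda>(i, j). gap d (fst S) (snd S) i j) ` ((- {fst S, snd S}) \<times> (- {fst S, snd S}))"
  have "Min ?G \<in> ?G" using assms by (intro Min_in) auto
  then obtain i j where "i \<notin> {fst S, snd S}" "j \<notin> {fst S, snd S}" "Min ?G = gap d (fst S) (snd S) i j"
    by auto
  moreover have "Min ?G \<le> 2 * isolation d S" by (auto simp: isolation_def)
  ultimately show ?thesis using that by metis
qed

lemma double_split_coord:
  "2 * split_coord d S f = min (2 * isolation d S) (f (fst S) + f (snd S) - d (fst S) (snd S))"
  by (auto simp: split_coord_def min_def)

text \<open>A triangle inequality is endangered only if the middle point is separated from both
  others, when its right side loses twice the isolation index. The gaps supply this slack:
  \<open>out\<close> takes it from a gap with equal outer points, \<open>inn\<close> from the gap at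
  \<open>i, k\<close>.\<close>

lemma remove_split_semimetric:
  assumes "semimetric_on UNIV d"
  shows "semimetric_on UNIV (remove_split d S)"
proof (cases "isolation d S = 0")
  case True
  then have "remove_split d S = d" by (auto simp: remove_split_def fun_eq_iff)
  with assms show ?thesis by simp
next
  case False
  define \<alpha> p q where "\<alpha> = isolation d S" and "p = fst S" and "q = snd S"
  note [simp] = p_def[symmetric] q_def[symmetric]
  have pos: "\<alpha> > 0" using False isolation_nonneg[of d S] by (simp add: \<alpha>_def)
  note iso = isolation_le_gap[OF pos[unfolded \<alpha>_def], folded \<alpha>_def p_def q_def, unfolded gap_def]
  have sym: "d i j = d j i" and zero: "d i i = 0" and tri: "d i k \<le> d i j + d j k" for i j k
    using semimetric_onD[OF assms] by auto
  let ?d = "remove_split d S"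
  have d': "?d i j = d i j - (if (i \<in> {p,q}) \<noteq> (j \<in> {p,q}) then \<alpha> else 0)" for i j
    unfolding remove_split_def separates_def \<alpha>_def p_def q_def by (rule refl)
  have out: "d i k + 2 * \<alpha> \<le> d i j + d j k" if "i \<in> {p,q}" "k \<in> {p,q}" "j \<notin> {p,q}" for i j k
  proof -
    have "2 * \<alpha> + d p q \<le> d p j + d q j" using iso[of j j] that(3) by (simp add: zero)
    then show ?thesis using that(1,2) sym[of p q] sym[of j p] sym[of j q]
        tri[of q j p] tri[of p j q] zero by auto
  qed
  have inn: "d i k + 2 * \<alpha> \<le> d i j + d j k" if "i \<notin> {p,q}" "k \<notin> {p,q}" "j \<in> {p,q}" for i j k
    using iso[of i k] that sym[of i p] sym[of i q] tri[of q k p] tri[of p k q] tri[of q i p] tri[of p i q] sym[of p q]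
    by auto
  have tri': "?d i k \<le> ?d i j + ?d j k" for i j k
    using out[of i k j] inn[of i k j] tri[of i k j] unfolding d' by argo
  have sym': "?d i j = ?d j i" for i j using sym[of i j] unfolding d' by auto
  have zero': "?d i i = 0" for i using zero unfolding d' by auto
  have "?d i j \<ge> 0" for i j using tri'[of i i j] sym'[of i j] zero'[of i] by simp
  then show ?thesis unfolding semimetric_on_def using sym' tri' zero' by blast
qed

context
  fixes d :: "'i::finite \<Rightarrow> 'i \<Rightarrow> real" and S :: "'i \<times> 'i" and f :: "'i \<Rightarrow> real"
  assumes d: "semimetric_on UNIV d" and f: "f \<in> tight_span d"
begin

lemma split_coord_bounds: "0 \<le> split_coord d S f" "split_coord d S f \<le> isolation d S"
proof -
  have "d (fst S) (snd S) \<le> f (fst S) + f (snd S)" using f by (simp add: tight_span_def dominating_def)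
  then show "0 \<le> split_coord d S f" using isolation_nonneg[of d S] by (simp add: split_coord_def)
qed (simp add: split_coord_def)

lemma split_coord_le:
  assumes "i \<in> {fst S, snd S}" "j \<in> {fst S, snd S}"
  shows "2 * split_coord d S f \<le> f i + f j - d i j"
proof -
  have "2 * split_coord d S f \<le> f (fst S) + f (snd S) - d (fst S) (snd S)"
    by (simp add: double_split_coord)
  then show ?thesis
    using assms tight_span_lipschitz[OF d f, of "fst S" "snd S"]
      tight_span_lipschitz[OF d f, of "snd S" "fst S"] semimetric_onD(2,3)[OF d, of "fst S" "snd S"]
      semimetric_onD(2)[OF d, of "snd S" "snd S"]
    by auto
qed

text \<open>Below the upper end, twice the coordinate is the excess at \<open>fst S, snd S\<close>.
  The gap at \<open>i, j\<close> compares the distances within the two sides with a crossing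
  pairing, which domination bounds by the sum of all four values of \<open>f\<close>.\<close>

lemma split_coord_ge:
  assumes "i \<notin> {fst S, snd S}" "j \<notin> {fst S, snd S}"
  shows "2 * (isolation d S - split_coord d S f) \<le> f i + f j - d i j"
proof -
  have dom: "d i j \<le> f i + f j" for i j using f by (simp add: tight_span_def dominating_def)
  show ?thesis
  proof (cases "isolation d S > 0")
    case True
    show ?thesis
      using isolation_le_gap[OF True assms] dom[of i j] dom[of "fst S" i] dom[of "fst S" j]
        dom[of "snd S" i] dom[of "snd S" j]
        double_split_coord[of d S f]
      unfolding gap_def by (simp add: min_def max_def split: if_splits)
  next
    case False
    then show ?thesis using isolation_nonneg[of d S] split_coord_bounds dom[of i j] by simp
  qed
qed

lemma contract_split_dominating: "remove_split d S i j \<le> contract_split d S f i + contract_split d S f j"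
proof -
  have "d i j \<le> f i + f j" using f by (simp add: tight_span_def dominating_def)
  then show ?thesis using split_coord_le[of i j] split_coord_ge[of i j]
    unfolding remove_split_def separates_def contract_split_def
    by (cases "i \<in> {fst S, snd S}"; cases "j \<in> {fst S, snd S}") simp_all
qed

lemma contract_split_tight:
  assumes "f i + f j = d i j"
  shows "contract_split d S f i + contract_split d S f j = remove_split d S i j"
  using split_coord_le[of i j] split_coord_ge[of i j] split_coord_bounds assms
  unfolding remove_split_def separates_def contract_split_def
  by (cases "i \<in> {fst S, snd S}"; cases "j \<in> {fst S, snd S}") simp_all

lemma split_coord_eq_0:
  assumes "f i + f j = d i j" "i \<in> {fst S, snd S}" "j \<in> {fst S, snd S}"
  shows "split_coord d S f = 0"
  using split_coord_le[of i j] split_coord_bounds assms by simp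

lemma split_coord_eq_isolation:
  assumes "f i + f j = d i j" "i \<notin> {fst S, snd S}" "j \<notin> {fst S, snd S}"
  shows "split_coord d S f = isolation d S"
  using split_coord_ge[of i j] split_coord_bounds assms by simp

lemma contract_split_tight_span: "contract_split d S f \<in> tight_span (remove_split d S)"
  using contract_split_dominating contract_split_tight f unfolding tight_span_def dominating_def by blast

text \<open>Below the upper end the coordinate is half the excess at the small side, and the
  contraction uses this excess up. The count of labels rests on the tight pair obtained
  here.\<close>

lemma contract_split_tight_pair:
  assumes "split_coord d S f < isolation d S"
  shows "contract_split d S f (fst S) + contract_split d S f (snd S) = remove_split d S (fst S) (snd S)"
  using assms double_split_coord[of d S f] unfolding contract_split_def remove_split_def separates_def
  by (simp add: min_def split: if_splits)

end

lemma contract_split_row: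
  assumes "semimetric_on UNIV d"
  shows "split_coord d S (d t) = (if t \<in> {fst S, snd S} then 0 else isolation d S)"
    and "contract_split d S (d t) = remove_split d S t"
proof -
  have zero: "d t t + d t t = d t t" using semimetric_onD(2)[OF assms, of t] by simp
  show *: "split_coord d S (d t) = (if t \<in> {fst S, snd S} then 0 else isolation d S)"
    using split_coord_eq_0[OF assms row_in_tight_span[OF assms] zero]
      split_coord_eq_isolation[OF assms row_in_tight_span[OF assms] zero] by simp
  show "contract_split d S (d t) = remove_split d S t"
    unfolding contract_split_def remove_split_def separates_def * by auto
qed

text \<open>Let \<Delta> be the difference of the coordinates, the larger one at \<open>f\<close>.
  On the small side \<open>f p + f q\<close> exceeds \<open>h p + h q\<close> by at least 2\<Delta>,
  while each summand grows by at most \<open>M\<close>; so neither can drop by more than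
  \<open>M\<close> - 2\<Delta>.\<close>

lemma contract_split_lipschitz:
  assumes d: "semimetric_on UNIV d" and f: "f \<in> tight_span d" and h: "h \<in> tight_span d"
    and M: "\<And>i. \<bar>f i - h i\<bar> \<le> M"
  shows "\<bar>contract_split d S f i - contract_split d S h i\<bar> \<le> M - \<bar>split_coord d S f - split_coord d S h\<bar>"
proof -
  have *: "\<bar>contract_split d S f i - contract_split d S h i\<bar> \<le> M - \<bar>split_coord d S f - split_coord d S h\<bar>"
    if le: "split_coord d S h \<le> split_coord d S f" and f: "f \<in> tight_span d" and h: "h \<in> tight_span d"
      and M: "\<And>i. \<bar>f i - h i\<bar> \<le> M" for f h
  proof (cases "split_coord d S f = split_coord d S h")
    case True
    then show ?thesis using M[of i] by (simp add: contract_split_def)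
  next
    case False
    define \<Delta> where "\<Delta> = split_coord d S f - split_coord d S h"
    have pos: "\<Delta> > 0" using le False by (simp add: \<Delta>_def)
    define p q where "p = fst S" and "q = snd S"
    have h_pq: "h p + h q = d p q + 2 * split_coord d S h"
      using pos split_coord_bounds(2)[OF d f, of S] double_split_coord[of d S h]
      by (auto simp: \<Delta>_def p_def q_def min_def split: if_splits)
    have f_pq: "d p q + 2 * split_coord d S f \<le> f p + f q"
      by (simp add: double_split_coord p_def q_def)
    have dec_p: "h p - f p + 2 * \<Delta> \<le> M"
      using h_pq f_pq abs_le_D1[OF M[of q]] unfolding \<Delta>_def by argo
    have dec_q: "h q - f q + 2 * \<Delta> \<le> M"
      using h_pq f_pq abs_le_D1[OF M[of p]] unfolding \<Delta>_def by argo
    note dec = dec_p dec_q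
    show ?thesis
    proof (cases "i \<in> {p, q}")
      case True
      then show ?thesis using dec M[of i] pos
        unfolding contract_split_def \<Delta>_def p_def[symmetric] q_def[symmetric] by auto
    next
      case i: False
      \<comment> \<open>A tight partner \<open>k\<close> of \<open>i\<close> at \<open>f\<close>
        provides the slack: on the small side through \<open>dec\<close>; on the large side the
        coordinate of \<open>f\<close> is at its upper end, and \<open>split_coord_ge\<close> gives
        \<open>h\<close> an excess of at least 2\<Delta> at \<open>i, k\<close>.\<close>
      have "f i - h i + 2 * \<Delta> \<le> M"
      proof -
        obtain k where k: "f i + f k = d i k" using f by (auto simp: tight_span_def)
        have hk: "d i k \<le> h i + h k" using h by (simp add: tight_span_def dominating_def)
        show ?thesis
        proof (cases "k \<in> {p, q}")
          case True
          then show ?thesis using dec k hk by auto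
        next
          case False
          have "2 * (isolation d S - split_coord d S h) \<le> h i + h k - d i k"
            using split_coord_ge[OF d h, of i S k] i False by (simp add: p_def q_def)
          moreover have "split_coord d S f = isolation d S"
            using split_coord_eq_isolation[OF d f k, of S] i False by (simp add: p_def q_def)
          ultimately show ?thesis using k abs_le_D2[OF M[of k]] unfolding \<Delta>_def by argo
        qed
      qed
      then show ?thesis using M[of i] pos i
        unfolding contract_split_def \<Delta>_def p_def[symmetric] q_def[symmetric] by auto
    qed
  qed
  show ?thesis
  proof (cases "split_coord d S h \<le> split_coord d S f")
    case True
    then show ?thesis using *[OF True f h M] by simp
  next
    case False
    then show ?thesis using *[OF _ h f] M by (simp add: abs_minus_commute)
  qed
qed

section \<open>Effect of removing a split on the gaps of other splits\<close>

lemma gap_commute: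
  assumes "semimetric_on UNIV d"
  shows "gap d p q i j = gap d i j p q" "gap d p q i j = gap d q p i j"
proof -
  have sym: "d i j = d j i" for i j using semimetric_onD(3)[OF assms] by auto
  show "gap d p q i j = gap d i j p q"
    using sym[of p i] sym[of q j] sym[of p j] sym[of q i] by (simp add: gap_def)
  show "gap d p q i j = gap d q p i j"
    using sym[of p q] by (simp add: gap_def max.commute add.commute)
qed

lemma isolation_le_gap':
  assumes "semimetric_on UNIV d" "isolation d S > 0" "{fst S, snd S} = {u, v}" "w \<notin> {u, v}" "z \<notin> {u, v}"
  shows "2 * isolation d S \<le> gap d u v w z"
  using isolation_le_gap[OF assms(2), of w z] assms(3-5) gap_commute(2)[OF assms(1), of u v w z]
  by (auto simp: doubleton_eq_iff)

context
  fixes d :: "'i::finite \<Rightarrow> 'i \<Rightarrow> real" and S :: "'i \<times> 'i" and p q i j :: 'i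
  assumes d: "semimetric_on UNIV d" and ij: "i \<notin> {p, q}" "j \<notin> {p, q}"
begin

text \<open>The sums belong to the three pairings of four points. Cutting off one point lowers all
  of them by \<alpha>. A cut into two and two lowers two sums by 2\<alpha> and spares the third,
  which was at least 2\<alpha> below the larger of the others. For the spared sum \<open>C\<close>
  this is claimed when \<open>p \<noteq> q\<close> and \<open>i \<noteq> j\<close>, since then the
  small side is exactly \<open>{p, q}\<close> or \<open>{i, j}\<close>.\<close>

lemma gap_remove_split_cases:
  defines "\<alpha> \<equiv> isolation d S"
  defines "A \<equiv> d p i + d q j" and "B \<equiv> d p j + d q i" and "C \<equiv> d p q + d i j"
  defines "A' \<equiv> remove_split d S p i + remove_split d S q j"
    and "B' \<equiv> remove_split d S p j + remove_split d S q i"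
    and "C' \<equiv> remove_split d S p q + remove_split d S i j"
  shows "A' = A \<and> B' = B \<and> C' = C
       \<or> A' = A - \<alpha> \<and> B' = B - \<alpha> \<and> C' = C - \<alpha>
       \<or> A' = A - 2 * \<alpha> \<and> B' = B - 2 * \<alpha> \<and> C' = C \<and> (p \<noteq> q \<and> i \<noteq> j \<longrightarrow> 2 * \<alpha> \<le> max A B - C)
       \<or> A' = A \<and> B' = B - 2 * \<alpha> \<and> C' = C - 2 * \<alpha> \<and> 2 * \<alpha> \<le> max B C - A
       \<or> A' = A - 2 * \<alpha> \<and> B' = B \<and> C' = C - 2 * \<alpha> \<and> 2 * \<alpha> \<le> max A C - B"
proof (cases "\<alpha> = 0")
  case True
  then show ?thesis
    by (intro disjI1) (simp add: assms(2-7) remove_split_def \<alpha>_def)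
next
  case False
  then have pos: "isolation d S > 0" using isolation_nonneg[of d S] by (simp add: \<alpha>_def)
  have sym: "d i j = d j i" for i j using semimetric_onD(3)[OF d] by auto
  have key: "2 * \<alpha> \<le> gap d u v w z"
    if "u \<in> {fst S, snd S}" "v \<in> {fst S, snd S}" "u \<noteq> v" "w \<notin> {fst S, snd S}" "z \<notin> {fst S, snd S}" for u v w z
    unfolding \<alpha>_def using that by (intro isolation_le_gap'[OF d pos]) auto
  define In where "In u \<longleftrightarrow> u \<in> {fst S, snd S}" for u
  have d': "remove_split d S u v = d u v - (if In u \<noteq> In v then \<alpha> else 0)" for u v
    unfolding remove_split_def separates_def In_def \<alpha>_def by (rule refl)
  have C_less: "2 * \<alpha> \<le> max A B - C"
    if "In p \<and> In q \<and> p \<noteq> q \<and> \<not> In i \<and> \<not> In j \<or> In i \<and> In j \<and> i \<noteq> j \<and> \<not> In p \<and> \<not> In q"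
    using that key[of p q i j] key[of i j p q] gap_commute(1)[OF d, of p q i j]
    unfolding assms(2-4) gap_def In_def by argo
  have A_less: "2 * \<alpha> \<le> max B C - A"
    if "In p \<and> In i \<and> \<not> In q \<and> \<not> In j \<or> In q \<and> In j \<and> \<not> In p \<and> \<not> In i"
  proof -
    have "2 * \<alpha> \<le> gap d p i q j"
      using that key[of p i q j] key[of q j p i] ij gap_commute(1)[OF d, of p i q j] unfolding In_def by auto
    then show ?thesis unfolding assms(2-4) gap_def using sym[of i j] sym[of i q] by (simp add: max.commute)
  qed
  have B_less: "2 * \<alpha> \<le> max A C - B"
    if "In p \<and> In j \<and> \<not> In q \<and> \<not> In i \<or> In q \<and> In i \<and> \<not> In p \<and> \<not> In j"
  proof -
    have "2 * \<alpha> \<le> gap d p j q i"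
      using that key[of p j q i] key[of q i p j] ij gap_commute(1)[OF d, of p j q i] unfolding In_def by auto
    then show ?thesis unfolding assms(2-4) gap_def using sym[of i j] sym[of j q] by (simp add: max.commute)
  qed
  show ?thesis
    using A_less B_less C_less unfolding assms(5-7) d' assms(2-4)
    by (cases "In p"; cases "In q"; cases "In i"; cases "In j") simp_all
qed

text \<open>Here \<open>C\<close> is a largest sum. A removal that lowers \<open>C\<close> by
  2\<alpha> and spares another sum presupposes that the spared one is at least 2\<alpha> below
  \<open>C\<close>.\<close>

lemma gap_remove_split_nonpos:
  assumes "gap d p q i j \<le> 0"
  shows "gap (remove_split d S) p q i j \<le> 0"
  using gap_remove_split_cases assms isolation_nonneg[of d S] unfolding gap_def
  by (elim disjE) (simp_all add: max_def split: if_splits)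

text \<open>Only a cut of \<open>p, q\<close> against \<open>i, j\<close> lowers the gap, and it
  lowers it by no more than its own value.\<close>

lemma gap_remove_split_neg:
  assumes "p \<noteq> q" "i \<noteq> j" "gap (remove_split d S) p q i j < 0"
  shows "gap d p q i j < 0"
  using gap_remove_split_cases assms isolation_nonneg[of d S] unfolding gap_def
  by (elim disjE) (simp_all add: max_def split: if_splits)

end

subsection \<open>Removing a sequence of splits\<close>

locale split_sequence =
  fixes d :: "'i::finite \<Rightarrow> 'i \<Rightarrow> real" and S :: "nat \<Rightarrow> 'i \<times> 'i"
  assumes semimetric: "semimetric_on UNIV d"
begin

primrec residual :: "nat \<Rightarrow> 'i \<Rightarrow> 'i \<Rightarrow> real" where
  "residual 0 = d"
| "residual (Suc n) = remove_split (residual n) (S n)"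

primrec contracted :: "nat \<Rightarrow> ('i \<Rightarrow> real) \<Rightarrow> 'i \<Rightarrow> real" where
  "contracted 0 f = f"
| "contracted (Suc n) f = contract_split (residual n) (S n) (contracted n f)"

definition side :: "nat \<Rightarrow> 'i set" where
  "side n = {fst (S n), snd (S n)}"

definition weight :: "nat \<Rightarrow> real" where
  "weight n = isolation (residual n) (S n)"

definition coord :: "nat \<Rightarrow> ('i \<Rightarrow> real) \<Rightarrow> real" where
  "coord n f = split_coord (residual n) (S n) (contracted n f)"

lemma weight_nonneg: "0 \<le> weight n"
  by (simp add: weight_def isolation_nonneg)

lemma residual_semimetric: "semimetric_on UNIV (residual n)"
  by (induction n) (simp_all add: semimetric remove_split_semimetric)

lemma contracted_tight_span:
  "f \<in> tight_span d \<Longrightarrow> contracted n f \<in> tight_span (residual n)"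
  by (induction n) (simp_all add: contract_split_tight_span residual_semimetric)

lemma contracted_row: "contracted n (d t) = residual n t"
  by (induction n) (simp_all add: contract_split_row(2) residual_semimetric)

lemma coord_row: "coord n (d t) = (if t \<in> side n then 0 else weight n)"
  unfolding coord_def contracted_row weight_def side_def
  by (rule contract_split_row(1)[OF residual_semimetric])

lemma coord_bounds:
  assumes "f \<in> tight_span d" shows "0 \<le> coord n f" "coord n f \<le> weight n"
  using split_coord_bounds[OF residual_semimetric contracted_tight_span[OF assms]]
  by (simp_all add: coord_def weight_def)

lemma residual_decomposition:
  "d i j = (\<Sum>k<n. if (i \<in> side k) \<noteq> (j \<in> side k) then weight k else 0) + residual n i j"
proof (induction n)
  case (Suc n)
  have "residual (Suc n) i j = residual n i j - (if (i \<in> side n) \<noteq> (j \<in> side n) then weight n else 0)"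
    unfolding residual.simps remove_split_def separates_def side_def weight_def by (rule refl)
  with Suc show ?case by simp
qed simp

lemma contracted_lipschitz:
  assumes "f \<in> tight_span d" "h \<in> tight_span d" "\<And>i. \<bar>f i - h i\<bar> \<le> M"
  shows "\<bar>contracted n f i - contracted n h i\<bar> \<le> M - (\<Sum>k<n. \<bar>coord k f - coord k h\<bar>)"
proof (induction n arbitrary: i)
  case 0
  show ?case using assms(3) by simp
next
  case (Suc n)
  show ?case
    using contract_split_lipschitz[OF residual_semimetric contracted_tight_span[OF assms(1)]
        contracted_tight_span[OF assms(2)] Suc]
    by (simp add: coord_def algebra_simps)
qed

lemma contracted_tight:
  assumes f: "f \<in> tight_span d" and tight: "contracted m f i + contracted m f j = residual m i j"
    and "m \<le> n"
  shows "contracted n f i + contracted n f j = residual n i j"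
  using \<open>m \<le> n\<close>
proof (induction n rule: dec_induct)
  case (step n)
  then show ?case
    using contract_split_tight[OF residual_semimetric contracted_tight_span[OF f] step.IH] by simp
qed (rule tight)

lemma contracted_tight_side:
  assumes f: "f \<in> tight_span d" and "coord m f < weight m" "m < n"
  shows "contracted n f (fst (S m)) + contracted n f (snd (S m)) = residual n (fst (S m)) (snd (S m))"
  using contracted_tight[OF f, of "Suc m" "fst (S m)" "snd (S m)" n] assms(2,3)
    contract_split_tight_pair[OF residual_semimetric contracted_tight_span[OF f], of m "S m"]
  by (simp add: coord_def weight_def)

text \<open>Below the upper end of split \<open>m\<close> its two members become a tight pair, which
  lies on the large side of \<open>n\<close> and forces that coordinate to its upper end. Tight
  pairs persist only to later stages; arguing by contradiction makes the claim symmetric and covers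
  both orders.\<close>

lemma coord_disjoint:
  assumes f: "f \<in> tight_span d" and "coord m f < weight m" "side m \<inter> side n = {}"
  shows "coord n f = weight n"
proof (rule ccontr)
  assume "coord n f \<noteq> weight n"
  then have less: "coord n f < weight n" using coord_bounds(2)[OF f, of n] by simp
  have *: False if "coord k f < weight k" "coord l f < weight l" "side k \<inter> side l = {}" "k < l" for k l
    using split_coord_eq_isolation[OF residual_semimetric contracted_tight_span[OF f]
        contracted_tight_side[OF f that(1,4)], of "S l"] that(2,3)
    by (auto simp: side_def coord_def weight_def)
  have "m \<noteq> n" using assms(3) by (auto simp: side_def)
  then consider "m < n" | "n < m" by linarith
  then show False using *[of m n] *[of n m] less assms(2,3) by cases (auto simp: Int_commute)
qed

text \<open>The tight pair is now \<open>p\<close> with itself, so the contracted function vanishes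
  at \<open>p\<close>: the whole interval leading to the terminal collapses onto it.\<close>

lemma contracted_eq_row:
  assumes f: "f \<in> tight_span d" and "coord m f < weight m" "S m = (p, p)" "m < n"
  shows "contracted n f = residual n p"
proof -
  have "residual n p p = 0" using semimetric_onD(2)[OF residual_semimetric, of p p n] by simp
  then have "contracted n f p = 0" using contracted_tight_side[OF f assms(2,4)] assms(3) by simp
  then show ?thesis by (intro tight_span_eq_row residual_semimetric contracted_tight_span f)
qed

lemma gap_residual_nonpos:
  assumes "i \<notin> {p, q}" "j \<notin> {p, q}" "gap (residual m) p q i j \<le> 0" "m \<le> n"
  shows "gap (residual n) p q i j \<le> 0"
  using assms(4)
proof (induction n rule: dec_induct)
  case (step n)
  then show ?case using gap_remove_split_nonpos[OF residual_semimetric assms(1,2)] by simp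
qed (rule assms(3))

lemma gap_residual_neg:
  assumes "i \<notin> {p, q}" "j \<notin> {p, q}" "p \<noteq> q" "i \<noteq> j" "m \<le> n" "gap (residual n) p q i j < 0"
  shows "gap (residual m) p q i j < 0"
  using assms(5,6)
proof (induction n rule: dec_induct)
  case (step n)
  then show ?case using gap_remove_split_neg[OF residual_semimetric assms(1-4)] by simp
qed

text \<open>The removal exhausts the gap at a minimizing pair, and nonpositive gaps persist.\<close>

lemma resolved_residual:
  assumes "n < m" "side n \<noteq> UNIV"
  obtains i j where "i \<notin> side n" "j \<notin> side n" "gap (residual m) (fst (S n)) (snd (S n)) i j \<le> 0"
proof -
  have "- {fst (S n), snd (S n)} \<noteq> {}" using assms(2) by (auto simp: side_def)
  then obtain i j where ij: "i \<notin> side n" "j \<notin> side n"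
      "gap (residual n) (fst (S n)) (snd (S n)) i j \<le> 2 * isolation (residual n) (S n)"
    unfolding side_def by (rule isolation_attained)
  then have "gap (residual (Suc n)) (fst (S n)) (snd (S n)) i j \<le> 0"
    by (auto simp: gap_def remove_split_def separates_def side_def max_def split: if_splits)
  then show ?thesis using gap_residual_nonpos[of i "fst (S n)" "snd (S n)" j "Suc n" m] ij assms(1) that
    by (simp add: side_def)
qed

text \<open>A gap that is nonpositive at stage \<open>m\<close> would still be so at stage
  \<open>n\<close> and exclude a positive isolation index. With \<open>m = 0\<close> this speaks
  about \<open>d\<close> itself.\<close>

lemma weight_pos_gap:
  assumes "weight n > 0" "side n = {p, q}" "i \<notin> {p, q}" "j \<notin> {p, q}" "m \<le> n"
  shows "gap (residual m) p q i j > 0"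
  using isolation_le_gap'[OF residual_semimetric, of n "S n" p q i j]
    gap_residual_nonpos[of i p q j m n] assms
  by (fastforce simp: weight_def side_def)

text \<open>The largest of the three sums of opposite distances in a 4-set does not have positive gap.\<close>

lemma not_three_splits:
  assumes "weight n1 > 0" "weight n2 > 0" "weight n3 > 0" "distinct [p, q, i, j]"
    and "side n1 = {p, q} \<or> side n1 = {i, j}" "side n2 = {p, i} \<or> side n2 = {q, j}"
      "side n3 = {p, j} \<or> side n3 = {q, i}"
  shows False
proof -
  have pos: "gap d u v w z > 0"
    if "weight n > 0" "side n = {u, v} \<or> side n = {w, z}" "distinct [u, v, w, z]" for n u v w z
    using weight_pos_gap[of n u v w z 0] weight_pos_gap[of n w z u v 0] that
      gap_commute(1)[OF semimetric, of u v w z] by auto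
  have sym: "d x y = d y x" for x y using semimetric_onD(3)[OF semimetric] by auto
  have "gap d p q i j > 0" "gap d p i q j > 0" "gap d p j q i > 0"
    using pos[OF assms(1,5)] pos[OF assms(2,6)] pos[OF assms(3,7)] assms(4) by auto
  then show False using sym[of i j] sym[of q i] sym[of q j]
    unfolding gap_def by (auto simp: max_def split: if_splits)
qed

end

subsection \<open>Five-point semimetrics without splits\<close>

text \<open>On five points this is the graph metric of the complete bipartite graph with parts \<open>{a, b}\<close>
  and its complement.\<close>

definition k23 :: "'i \<Rightarrow> 'i \<Rightarrow> 'i \<Rightarrow> 'i \<Rightarrow> real" where
  "k23 a b i j = (if i = j then 0 else if (i \<in> {a, b}) \<noteq> (j \<in> {a, b}) then 1 else 2)"

text \<open>The variable \<open>dij\<close> is the distance of the points \<open>i < j\<close>. After the triangle inequalities, the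
  assumptions say that no singleton and no pair is the small side of a split; the disjuncts of the
  conclusion are the ten choices of \<open>{a, b}\<close>.\<close>

lemma five_point_prime_arith:
  fixes d01 d02 d03 d04 d12 d13 d14 d23 d24 d34 :: real
  assumes "d12 \<le> d01 + d02" "d13 \<le> d01 + d03" "d14 \<le> d01 + d04"
    "d23 \<le> d02 + d03" "d24 \<le> d02 + d04" "d34 \<le> d03 + d04"
    "d02 \<le> d01 + d12" "d03 \<le> d01 + d13" "d04 \<le> d01 + d14"
    "d23 \<le> d12 + d13" "d24 \<le> d12 + d14" "d34 \<le> d13 + d14"
    "d01 \<le> d02 + d12" "d03 \<le> d02 + d23" "d04 \<le> d02 + d24"
    "d13 \<le> d12 + d23" "d14 \<le> d12 + d24" "d34 \<le> d23 + d24"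
    "d01 \<le> d03 + d13" "d02 \<le> d03 + d23" "d04 \<le> d03 + d34"
    "d12 \<le> d13 + d23" "d14 \<le> d13 + d34" "d24 \<le> d23 + d34"
    "d01 \<le> d04 + d14" "d02 \<le> d04 + d24" "d03 \<le> d04 + d34"
    "d12 \<le> d14 + d24" "d13 \<le> d14 + d34" "d23 \<le> d24 + d34"
    and "d01 + d02 \<le> d12 \<or> d01 + d03 \<le> d13 \<or> d01 + d04 \<le> d14 \<or> d02 + d03 \<le> d23 \<or> d02 + d04 \<le> d24 \<or> d03 + d04 \<le> d34"
    "d01 + d12 \<le> d02 \<or> d01 + d13 \<le> d03 \<or> d01 + d14 \<le> d04 \<or> d12 + d13 \<le> d23 \<or> d12 + d14 \<le> d24 \<or> d13 + d14 \<le> d34"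
    "d02 + d12 \<le> d01 \<or> d02 + d23 \<le> d03 \<or> d02 + d24 \<le> d04 \<or> d12 + d23 \<le> d13 \<or> d12 + d24 \<le> d14 \<or> d23 + d24 \<le> d34"
    "d03 + d13 \<le> d01 \<or> d03 + d23 \<le> d02 \<or> d03 + d34 \<le> d04 \<or> d13 + d23 \<le> d12 \<or> d13 + d34 \<le> d14 \<or> d23 + d34 \<le> d24"
    "d04 + d14 \<le> d01 \<or> d04 + d24 \<le> d02 \<or> d04 + d34 \<le> d03 \<or> d14 + d24 \<le> d12 \<or> d14 + d34 \<le> d13 \<or> d24 + d34 \<le> d23"
    and "d02 + d13 \<le> d01 + d23 \<and> d03 + d12 \<le> d01 + d23 \<or> d02 + d14 \<le> d01 + d24 \<and> d04 + d12 \<le> d01 + d24 \<or> d03 + d14 \<le> d01 + d34 \<and> d04 + d13 \<le> d01 + d34"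
    "d01 + d23 \<le> d02 + d13 \<and> d03 + d12 \<le> d02 + d13 \<or> d01 + d24 \<le> d02 + d14 \<and> d04 + d12 \<le> d02 + d14 \<or> d03 + d24 \<le> d02 + d34 \<and> d04 + d23 \<le> d02 + d34"
    "d01 + d23 \<le> d03 + d12 \<and> d02 + d13 \<le> d03 + d12 \<or> d01 + d34 \<le> d03 + d14 \<and> d04 + d13 \<le> d03 + d14 \<or> d02 + d34 \<le> d03 + d24 \<and> d04 + d23 \<le> d03 + d24"
    "d01 + d24 \<le> d04 + d12 \<and> d02 + d14 \<le> d04 + d12 \<or> d01 + d34 \<le> d04 + d13 \<and> d03 + d14 \<le> d04 + d13 \<or> d02 + d34 \<le> d04 + d23 \<and> d03 + d24 \<le> d04 + d23"
    "d01 + d23 \<le> d12 + d03 \<and> d13 + d02 \<le> d12 + d03 \<or> d01 + d24 \<le> d12 + d04 \<and> d14 + d02 \<le> d12 + d04 \<or> d13 + d24 \<le> d12 + d34 \<and> d14 + d23 \<le> d12 + d34"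
    "d01 + d23 \<le> d13 + d02 \<and> d12 + d03 \<le> d13 + d02 \<or> d01 + d34 \<le> d13 + d04 \<and> d14 + d03 \<le> d13 + d04 \<or> d12 + d34 \<le> d13 + d24 \<and> d14 + d23 \<le> d13 + d24"
    "d01 + d24 \<le> d14 + d02 \<and> d12 + d04 \<le> d14 + d02 \<or> d01 + d34 \<le> d14 + d03 \<and> d13 + d04 \<le> d14 + d03 \<or> d12 + d34 \<le> d14 + d23 \<and> d13 + d24 \<le> d14 + d23"
    "d02 + d13 \<le> d23 + d01 \<and> d12 + d03 \<le> d23 + d01 \<or> d02 + d34 \<le> d23 + d04 \<and> d24 + d03 \<le> d23 + d04 \<or> d12 + d34 \<le> d23 + d14 \<and> d24 + d13 \<le> d23 + d14"
    "d02 + d14 \<le> d24 + d01 \<and> d12 + d04 \<le> d24 + d01 \<or> d02 + d34 \<le> d24 + d03 \<and> d23 + d04 \<le> d24 + d03 \<or> d12 + d34 \<le> d24 + d13 \<and> d23 + d14 \<le> d24 + d13"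
    "d03 + d14 \<le> d34 + d01 \<and> d13 + d04 \<le> d34 + d01 \<or> d03 + d24 \<le> d34 + d02 \<and> d23 + d04 \<le> d34 + d02 \<or> d13 + d24 \<le> d34 + d12 \<and> d23 + d14 \<le> d34 + d12"
  shows "d03 = d02 \<and> d04 = d02 \<and> d12 = d02 \<and> d13 = d02 \<and> d14 = d02 \<and> d01 = 2 * d02 \<and> d23 = 2 * d02 \<and> d24 = 2 * d02 \<and> d34 = 2 * d02
    \<or> d03 = d01 \<and> d04 = d01 \<and> d12 = d01 \<and> d23 = d01 \<and> d24 = d01 \<and> d02 = 2 * d01 \<and> d13 = 2 * d01 \<and> d14 = 2 * d01 \<and> d34 = 2 * d01
    \<or> d02 = d01 \<and> d04 = d01 \<and> d13 = d01 \<and> d23 = d01 \<and> d34 = d01 \<and> d03 = 2 * d01 \<and> d12 = 2 * d01 \<and> d14 = 2 * d01 \<and> d24 = 2 * d01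
    \<or> d02 = d01 \<and> d03 = d01 \<and> d14 = d01 \<and> d24 = d01 \<and> d34 = d01 \<and> d04 = 2 * d01 \<and> d12 = 2 * d01 \<and> d13 = 2 * d01 \<and> d23 = 2 * d01
    \<or> d13 = d01 \<and> d14 = d01 \<and> d02 = d01 \<and> d23 = d01 \<and> d24 = d01 \<and> d12 = 2 * d01 \<and> d03 = 2 * d01 \<and> d04 = 2 * d01 \<and> d34 = 2 * d01
    \<or> d12 = d01 \<and> d14 = d01 \<and> d03 = d01 \<and> d23 = d01 \<and> d34 = d01 \<and> d13 = 2 * d01 \<and> d02 = 2 * d01 \<and> d04 = 2 * d01 \<and> d24 = 2 * d01
    \<or> d12 = d01 \<and> d13 = d01 \<and> d04 = d01 \<and> d24 = d01 \<and> d34 = d01 \<and> d14 = 2 * d01 \<and> d02 = 2 * d01 \<and> d03 = 2 * d01 \<and> d23 = 2 * d01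
    \<or> d12 = d02 \<and> d24 = d02 \<and> d03 = d02 \<and> d13 = d02 \<and> d34 = d02 \<and> d23 = 2 * d02 \<and> d01 = 2 * d02 \<and> d04 = 2 * d02 \<and> d14 = 2 * d02
    \<or> d12 = d02 \<and> d23 = d02 \<and> d04 = d02 \<and> d14 = d02 \<and> d34 = d02 \<and> d24 = 2 * d02 \<and> d01 = 2 * d02 \<and> d03 = 2 * d02 \<and> d13 = 2 * d02
    \<or> d13 = d03 \<and> d23 = d03 \<and> d04 = d03 \<and> d14 = d03 \<and> d24 = d03 \<and> d34 = 2 * d03 \<and> d01 = 2 * d03 \<and> d02 = 2 * d03 \<and> d12 = 2 * d03"
  using assms by (smt (z3))

lemma five_point_prime:
  fixes d :: "'i::finite \<Rightarrow> 'i \<Rightarrow> real"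
  assumes card: "CARD('i) = 5" and d: "semimetric_on UNIV d"
    and resolved: "\<And>p q. \<exists>i j. i \<notin> {p, q} \<and> j \<notin> {p, q} \<and> gap d p q i j \<le> 0"
  obtains a b \<beta> where "a \<noteq> b" "0 \<le> \<beta>" "\<And>i j. d i j = \<beta> * k23 a b i j"
proof -
  note result = that
  have sym: "d x y = d y x" and zero: "d x x = 0" and nonneg: "0 \<le> d x y" for x y
    using semimetric_onD[OF d] by auto
  have tri: "d x y \<le> d x z + d y z" for x y z
    using semimetric_onD(4)[OF d, of x z y] sym[of z y] by simp
  obtain xs :: "'i list" where xs: "set xs = UNIV" "distinct xs"
    using finite_distinct_list[OF finite] by blast
  then have "length xs = 5" using distinct_card[of xs] card by simp
  then obtain x0 x1 x2 x3 x4 where "xs = [x0, x1, x2, x3, x4]"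
    by (auto simp: eval_nat_numeral length_Suc_conv)
  with xs have U: "UNIV = {x0, x1, x2, x3, x4}" and dist: "distinct [x0, x1, x2, x3, x4]" by auto
  have res: "\<exists>i j. i \<notin> {p, q} \<and> j \<notin> {p, q} \<and> i \<noteq> j \<and> d p i + d q j \<le> d p q + d i j \<and> d p j + d q i \<le> d p q + d i j"
    for p q
  proof -
    obtain i j where ij: "i \<notin> {p, q}" "j \<notin> {p, q}" "gap d p q i j \<le> 0" using resolved by blast
    show ?thesis
    proof (cases "i = j")
      case False
      then show ?thesis using ij by (intro exI[of _ i] exI[of _ j]) (auto simp: gap_def)
    next
      case True
      \<comment> \<open>Equal witnesses mean that \<open>i\<close> lies between \<open>p\<close> and
        \<open>q\<close>; then \<open>i\<close> and any further point \<open>k\<close> are distinct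
        witnesses.\<close>
      have "card {p, q, i} < CARD('i)" using card_length[of "[p, q, i]"] card by simp
      then have "{p, q, i} \<noteq> UNIV" by auto
      then obtain k where k: "k \<notin> {p, q, i}" by blast
      have "d p i + d q i \<le> d p q" using ij(3) True zero[of i] by (auto simp: gap_def)
      then have "d p i + d q k \<le> d p q + d i k \<and> d p k + d q i \<le> d p q + d i k"
        using tri[of q k i] tri[of p k i] sym[of k i] by linarith
      then show ?thesis using ij(1) k by (intro exI[of _ i] exI[of _ k]) auto
    qed
  qed
  define W where "W p q i j \<longleftrightarrow> d p i + d q j \<le> d p q + d i j \<and> d p j + d q i \<le> d p q + d i j" for p q i j
  have W_commute: "W p q i j \<longleftrightarrow> W p q j i" for p q i j unfolding W_def using sym[of i j] by auto
  have pair: "W p q r s \<or> W p q r t \<or> W p q s t"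
    if U: "UNIV = {p, q, r, s, t}" for p q r s t
  proof -
    obtain i j where ij: "i \<notin> {p, q}" "j \<notin> {p, q}" "i \<noteq> j" "W p q i j"
      using res[of p q] unfolding W_def by blast
    have "i \<in> {p, q, r, s, t}" "j \<in> {p, q, r, s, t}" unfolding U[symmetric] by auto
    then show ?thesis using ij W_commute by auto
  qed
  have single: "W p p q r \<or> W p p q s \<or> W p p q t \<or> W p p r s \<or> W p p r t \<or> W p p s t"
    if U: "UNIV = {p, q, r, s, t}" for p q r s t
  proof -
    obtain i j where ij: "i \<noteq> p" "j \<noteq> p" "i \<noteq> j" "W p p i j"
      using res[of p p] unfolding W_def by blast
    have "i \<in> {p, q, r, s, t}" "j \<in> {p, q, r, s, t}" unfolding U[symmetric] by auto
    then show ?thesis using ij W_commute by auto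
  qed
  have Wp: "W p p i j \<longleftrightarrow> d p i + d p j \<le> d i j" for p i j
    unfolding W_def using zero[of p] by auto
  note sym_rules = sym[of x1 x0] sym[of x2 x0] sym[of x3 x0] sym[of x4 x0] sym[of x2 x1] sym[of x3 x1] sym[of x4 x1] sym[of x3 x2] sym[of x4 x2] sym[of x4 x3]
  have single0: "d x0 x1 + d x0 x2 \<le> d x1 x2 \<or> d x0 x1 + d x0 x3 \<le> d x1 x3 \<or> d x0 x1 + d x0 x4 \<le> d x1 x4 \<or> d x0 x2 + d x0 x3 \<le> d x2 x3 \<or> d x0 x2 + d x0 x4 \<le> d x2 x4 \<or> d x0 x3 + d x0 x4 \<le> d x3 x4"
    using single[of x0 x1 x2 x3 x4] U unfolding Wp sym_rules by (simp add: insert_commute)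
  have single1: "d x0 x1 + d x1 x2 \<le> d x0 x2 \<or> d x0 x1 + d x1 x3 \<le> d x0 x3 \<or> d x0 x1 + d x1 x4 \<le> d x0 x4 \<or> d x1 x2 + d x1 x3 \<le> d x2 x3 \<or> d x1 x2 + d x1 x4 \<le> d x2 x4 \<or> d x1 x3 + d x1 x4 \<le> d x3 x4"
    using single[of x1 x0 x2 x3 x4] U unfolding Wp sym_rules by (simp add: insert_commute)
  have single2: "d x0 x2 + d x1 x2 \<le> d x0 x1 \<or> d x0 x2 + d x2 x3 \<le> d x0 x3 \<or> d x0 x2 + d x2 x4 \<le> d x0 x4 \<or> d x1 x2 + d x2 x3 \<le> d x1 x3 \<or> d x1 x2 + d x2 x4 \<le> d x1 x4 \<or> d x2 x3 + d x2 x4 \<le> d x3 x4"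
    using single[of x2 x0 x1 x3 x4] U unfolding Wp sym_rules by (simp add: insert_commute)
  have single3: "d x0 x3 + d x1 x3 \<le> d x0 x1 \<or> d x0 x3 + d x2 x3 \<le> d x0 x2 \<or> d x0 x3 + d x3 x4 \<le> d x0 x4 \<or> d x1 x3 + d x2 x3 \<le> d x1 x2 \<or> d x1 x3 + d x3 x4 \<le> d x1 x4 \<or> d x2 x3 + d x3 x4 \<le> d x2 x4"
    using single[of x3 x0 x1 x2 x4] U unfolding Wp sym_rules by (simp add: insert_commute)
  have single4: "d x0 x4 + d x1 x4 \<le> d x0 x1 \<or> d x0 x4 + d x2 x4 \<le> d x0 x2 \<or> d x0 x4 + d x3 x4 \<le> d x0 x3 \<or> d x1 x4 + d x2 x4 \<le> d x1 x2 \<or> d x1 x4 + d x3 x4 \<le> d x1 x3 \<or> d x2 x4 + d x3 x4 \<le> d x2 x3"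
    using single[of x4 x0 x1 x2 x3] U unfolding Wp sym_rules by (simp add: insert_commute)
  have pair01: "d x0 x2 + d x1 x3 \<le> d x0 x1 + d x2 x3 \<and> d x0 x3 + d x1 x2 \<le> d x0 x1 + d x2 x3 \<or> d x0 x2 + d x1 x4 \<le> d x0 x1 + d x2 x4 \<and> d x0 x4 + d x1 x2 \<le> d x0 x1 + d x2 x4 \<or> d x0 x3 + d x1 x4 \<le> d x0 x1 + d x3 x4 \<and> d x0 x4 + d x1 x3 \<le> d x0 x1 + d x3 x4"
    using pair[of x0 x1 x2 x3 x4] U unfolding W_def sym_rules by (simp add: insert_commute)
  have pair02: "d x0 x1 + d x2 x3 \<le> d x0 x2 + d x1 x3 \<and> d x0 x3 + d x1 x2 \<le> d x0 x2 + d x1 x3 \<or> d x0 x1 + d x2 x4 \<le> d x0 x2 + d x1 x4 \<and> d x0 x4 + d x1 x2 \<le> d x0 x2 + d x1 x4 \<or> d x0 x3 + d x2 x4 \<le> d x0 x2 + d x3 x4 \<and> d x0 x4 + d x2 x3 \<le> d x0 x2 + d x3 x4"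
    using pair[of x0 x2 x1 x3 x4] U unfolding W_def sym_rules by (simp add: insert_commute)
  have pair03: "d x0 x1 + d x2 x3 \<le> d x0 x3 + d x1 x2 \<and> d x0 x2 + d x1 x3 \<le> d x0 x3 + d x1 x2 \<or> d x0 x1 + d x3 x4 \<le> d x0 x3 + d x1 x4 \<and> d x0 x4 + d x1 x3 \<le> d x0 x3 + d x1 x4 \<or> d x0 x2 + d x3 x4 \<le> d x0 x3 + d x2 x4 \<and> d x0 x4 + d x2 x3 \<le> d x0 x3 + d x2 x4"
    using pair[of x0 x3 x1 x2 x4] U unfolding W_def sym_rules by (simp add: insert_commute)
  have pair04: "d x0 x1 + d x2 x4 \<le> d x0 x4 + d x1 x2 \<and> d x0 x2 + d x1 x4 \<le> d x0 x4 + d x1 x2 \<or> d x0 x1 + d x3 x4 \<le> d x0 x4 + d x1 x3 \<and> d x0 x3 + d x1 x4 \<le> d x0 x4 + d x1 x3 \<or> d x0 x2 + d x3 x4 \<le> d x0 x4 + d x2 x3 \<and> d x0 x3 + d x2 x4 \<le> d x0 x4 + d x2 x3"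
    using pair[of x0 x4 x1 x2 x3] U unfolding W_def sym_rules by (simp add: insert_commute)
  have pair12: "d x0 x1 + d x2 x3 \<le> d x1 x2 + d x0 x3 \<and> d x1 x3 + d x0 x2 \<le> d x1 x2 + d x0 x3 \<or> d x0 x1 + d x2 x4 \<le> d x1 x2 + d x0 x4 \<and> d x1 x4 + d x0 x2 \<le> d x1 x2 + d x0 x4 \<or> d x1 x3 + d x2 x4 \<le> d x1 x2 + d x3 x4 \<and> d x1 x4 + d x2 x3 \<le> d x1 x2 + d x3 x4"
    using pair[of x1 x2 x0 x3 x4] U unfolding W_def sym_rules by (simp add: insert_commute)
  have pair13: "d x0 x1 + d x2 x3 \<le> d x1 x3 + d x0 x2 \<and> d x1 x2 + d x0 x3 \<le> d x1 x3 + d x0 x2 \<or> d x0 x1 + d x3 x4 \<le> d x1 x3 + d x0 x4 \<and> d x1 x4 + d x0 x3 \<le> d x1 x3 + d x0 x4 \<or> d x1 x2 + d x3 x4 \<le> d x1 x3 + d x2 x4 \<and> d x1 x4 + d x2 x3 \<le> d x1 x3 + d x2 x4"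
    using pair[of x1 x3 x0 x2 x4] U unfolding W_def sym_rules by (simp add: insert_commute)
  have pair14: "d x0 x1 + d x2 x4 \<le> d x1 x4 + d x0 x2 \<and> d x1 x2 + d x0 x4 \<le> d x1 x4 + d x0 x2 \<or> d x0 x1 + d x3 x4 \<le> d x1 x4 + d x0 x3 \<and> d x1 x3 + d x0 x4 \<le> d x1 x4 + d x0 x3 \<or> d x1 x2 + d x3 x4 \<le> d x1 x4 + d x2 x3 \<and> d x1 x3 + d x2 x4 \<le> d x1 x4 + d x2 x3"
    using pair[of x1 x4 x0 x2 x3] U unfolding W_def sym_rules by (simp add: insert_commute)
  have pair23: "d x0 x2 + d x1 x3 \<le> d x2 x3 + d x0 x1 \<and> d x1 x2 + d x0 x3 \<le> d x2 x3 + d x0 x1 \<or> d x0 x2 + d x3 x4 \<le> d x2 x3 + d x0 x4 \<and> d x2 x4 + d x0 x3 \<le> d x2 x3 + d x0 x4 \<or> d x1 x2 + d x3 x4 \<le> d x2 x3 + d x1 x4 \<and> d x2 x4 + d x1 x3 \<le> d x2 x3 + d x1 x4"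
    using pair[of x2 x3 x0 x1 x4] U unfolding W_def sym_rules by (simp add: insert_commute)
  have pair24: "d x0 x2 + d x1 x4 \<le> d x2 x4 + d x0 x1 \<and> d x1 x2 + d x0 x4 \<le> d x2 x4 + d x0 x1 \<or> d x0 x2 + d x3 x4 \<le> d x2 x4 + d x0 x3 \<and> d x2 x3 + d x0 x4 \<le> d x2 x4 + d x0 x3 \<or> d x1 x2 + d x3 x4 \<le> d x2 x4 + d x1 x3 \<and> d x2 x3 + d x1 x4 \<le> d x2 x4 + d x1 x3"
    using pair[of x2 x4 x0 x1 x3] U unfolding W_def sym_rules by (simp add: insert_commute)
  have pair34: "d x0 x3 + d x1 x4 \<le> d x3 x4 + d x0 x1 \<and> d x1 x3 + d x0 x4 \<le> d x3 x4 + d x0 x1 \<or> d x0 x3 + d x2 x4 \<le> d x3 x4 + d x0 x2 \<and> d x2 x3 + d x0 x4 \<le> d x3 x4 + d x0 x2 \<or> d x1 x3 + d x2 x4 \<le> d x3 x4 + d x1 x2 \<and> d x2 x3 + d x1 x4 \<le> d x3 x4 + d x1 x2"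
    using pair[of x3 x4 x0 x1 x2] U unfolding W_def sym_rules by (simp add: insert_commute)
  have k23: thesis if "distinct [a, b, r, s, t]" "UNIV = {a, b, r, s, t}"
    "d a s = d a r" "d a t = d a r" "d b r = d a r" "d b s = d a r" "d b t = d a r"
    "d a b = 2 * d a r" "d r s = 2 * d a r" "d r t = 2 * d a r" "d s t = 2 * d a r" for a b r s t
  proof (rule result[of a b "d a r"])
    show "d i j = d a r * k23 a b i j" for i j
    proof -
      have "i \<in> {a, b, r, s, t}" "j \<in> {a, b, r, s, t}" using that(2) by auto
      then show ?thesis using that(1,3-) zero sym[of b a] sym[of r a] sym[of r b] sym[of s a] sym[of s b] sym[of s r]
          sym[of t a] sym[of t b] sym[of t r] sym[of t s] by (auto simp: k23_def)
    qed
  qed (use that(1) nonneg in auto)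
  show thesis
    using five_point_prime_arith[OF tri[of x1 x2 x0, unfolded sym_rules] tri[of x1 x3 x0, unfolded sym_rules] tri[of x1 x4 x0, unfolded sym_rules]
      tri[of x2 x3 x0, unfolded sym_rules] tri[of x2 x4 x0, unfolded sym_rules] tri[of x3 x4 x0, unfolded sym_rules]
      tri[of x0 x2 x1, unfolded sym_rules] tri[of x0 x3 x1, unfolded sym_rules] tri[of x0 x4 x1, unfolded sym_rules]
      tri[of x2 x3 x1, unfolded sym_rules] tri[of x2 x4 x1, unfolded sym_rules] tri[of x3 x4 x1, unfolded sym_rules]
      tri[of x0 x1 x2, unfolded sym_rules] tri[of x0 x3 x2, unfolded sym_rules] tri[of x0 x4 x2, unfolded sym_rules]
      tri[of x1 x3 x2, unfolded sym_rules] tri[of x1 x4 x2, unfolded sym_rules] tri[of x3 x4 x2, unfolded sym_rules]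
      tri[of x0 x1 x3, unfolded sym_rules] tri[of x0 x2 x3, unfolded sym_rules] tri[of x0 x4 x3, unfolded sym_rules]
      tri[of x1 x2 x3, unfolded sym_rules] tri[of x1 x4 x3, unfolded sym_rules] tri[of x2 x4 x3, unfolded sym_rules]
      tri[of x0 x1 x4, unfolded sym_rules] tri[of x0 x2 x4, unfolded sym_rules] tri[of x0 x3 x4, unfolded sym_rules]
      tri[of x1 x2 x4, unfolded sym_rules] tri[of x1 x3 x4, unfolded sym_rules] tri[of x2 x3 x4, unfolded sym_rules]
      single0 single1 single2 single3 single4
      pair01 pair02 pair03 pair04 pair12 pair13 pair14 pair23 pair24 pair34]
    apply (elim disjE)
    subgoal by (rule k23[of x0 x1 x2 x3 x4]) (use dist U in \<open>auto simp: sym_rules\<close>)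
    subgoal by (rule k23[of x0 x2 x1 x3 x4]) (use dist U in \<open>auto simp: sym_rules\<close>)
    subgoal by (rule k23[of x0 x3 x1 x2 x4]) (use dist U in \<open>auto simp: sym_rules\<close>)
    subgoal by (rule k23[of x0 x4 x1 x2 x3]) (use dist U in \<open>auto simp: sym_rules\<close>)
    subgoal by (rule k23[of x1 x2 x0 x3 x4]) (use dist U in \<open>auto simp: sym_rules\<close>)
    subgoal by (rule k23[of x1 x3 x0 x2 x4]) (use dist U in \<open>auto simp: sym_rules\<close>)
    subgoal by (rule k23[of x1 x4 x0 x2 x3]) (use dist U in \<open>auto simp: sym_rules\<close>)
    subgoal by (rule k23[of x2 x3 x0 x1 x4]) (use dist U in \<open>auto simp: sym_rules\<close>)
    subgoal by (rule k23[of x2 x4 x0 x1 x3]) (use dist U in \<open>auto simp: sym_rules\<close>)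
    subgoal by (rule k23[of x3 x4 x0 x1 x2]) (use dist U in \<open>auto simp: sym_rules\<close>)
    done
qed

subsection \<open>Averaging over thresholds\<close>

text \<open>The threshold has to be interior: terminals have coordinates 0 and \<alpha>, and must be
  rounded to themselves.\<close>

lemma exists_le_average:
  fixes g :: "real \<Rightarrow> real"
  assumes "0 < \<alpha>" "(g has_integral I) {0..\<alpha>}" "\<And>\<theta>. 0 \<le> g \<theta>"
  obtains \<theta> where "0 < \<theta>" "\<theta> < \<alpha>" "\<alpha> * g \<theta> \<le> I"
proof (rule ccontr)
  assume "\<not> thesis"
  with that have less: "I / \<alpha> < g \<theta>" if "0 < \<theta>" "\<theta> < \<alpha>" for \<theta>
    using that assms(1) by (force simp: field_simps not_le)
  let ?M = "lebesgue_on {0<..<\<alpha>}"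
  interpret finite_measure ?M by (rule finite_measure_lebesgue_on) simp
  have int: "(g has_integral I) {0<..<\<alpha>}"
    using assms(2) by (simp add: has_integral_Icc_iff_Ioo)
  have "g absolutely_integrable_on {0<..<\<alpha>}"
    using int assms(3) by (intro nonnegative_absolutely_integrable_1) auto
  then have g: "integrable ?M g" by (rule absolutely_integrable_imp_integrable) simp
  have "integral\<^sup>L ?M (\<lambda>_. I / \<alpha>) < integral\<^sup>L ?M g"
    using g assms(1) less
    by (intro integral_less_AE_space) (auto intro!: AE_I2 simp: emeasure_restrict_space)
  moreover have "integral\<^sup>L ?M g = I"
    using g int by (simp add: lebesgue_integral_eq_integral integral_unique)
  moreover have "integral\<^sup>L ?M (\<lambda>_. I / \<alpha>) = I"
    using assms(1) by (simp add: measure_restrict_space)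
  ultimately show False by simp
qed

lemma has_integral_interval:
  fixes l r \<alpha> :: real
  assumes "0 \<le> l" "r \<le> \<alpha>"
  shows "((\<lambda>\<theta>. of_bool (l < \<theta> \<and> \<theta> \<le> r)) has_integral max 0 (r - l)) {0..\<alpha>}"
proof (cases "l \<le> r")
  case True
  have "((\<lambda>\<theta>. 1::real) has_integral (r - l)) {l..r}"
    using has_integral_const_real[of "1::real" l r] True by simp
  then have "((\<lambda>\<theta>. if \<theta> \<in> {l..r} then 1 else 0::real) has_integral (r - l)) {0..\<alpha>}"
    using has_integral_restrict_closed_subinterval[of "\<lambda>_. 1::real" "r - l" l r 0 \<alpha>] assms by simp
  then have "((\<lambda>\<theta>. of_bool (l < \<theta> \<and> \<theta> \<le> r)) has_integral (r - l)) {0..\<alpha>}"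
    by (rule has_integral_spike_finite[of "{l}", rotated 2]) auto
  then show ?thesis using True by simp
next
  case False
  then have "(\<lambda>\<theta>. of_bool (l < \<theta> \<and> \<theta> \<le> r)) = (\<lambda>_. 0::real)" by auto
  then show ?thesis using False by simp
qed

subsection \<open>Rounding in the tight span of the complete bipartite graph on 2 + 3 vertices\<close>

text \<open>The tight span consists of right isosceles triangles \<open>a, i, b\<close> with legs of length \<open>\<beta>\<close>
  that share the hypotenuse from \<open>a\<close> to \<open>b\<close>. Placing \<open>a = (0, 0)\<close>, \<open>i = (\<beta>, 0)\<close>, \<open>b = (\<beta>, \<beta>)\<close>, a point has
  coordinates \<open>\<beta> \<ge> tri_hi \<ge> tri_lo \<ge> 0\<close> in the triangle \<open>i = apex\<close>, and both coordinates are compared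
  with the same threshold.\<close>

definition apex :: "'i \<Rightarrow> 'i \<Rightarrow> ('i::finite \<Rightarrow> real) \<Rightarrow> 'i" where
  "apex a b f = arg_min_on f (- {a, b})"

text \<open>With \<open>tri_lo\<close>, the solution of \<open>f a = hi + lo\<close> and
  \<open>f i = \<beta> - hi + lo\<close>, the l1 distances of the point \<open>(hi, lo)\<close> from
  \<open>a\<close> and from the apex \<open>i\<close>.\<close>

definition tri_hi :: "'i \<Rightarrow> 'i \<Rightarrow> real \<Rightarrow> ('i::finite \<Rightarrow> real) \<Rightarrow> real" where
  "tri_hi a b \<beta> f = (f a + \<beta> - f (apex a b f)) / 2"

definition tri_lo :: "'i \<Rightarrow> 'i \<Rightarrow> real \<Rightarrow> ('i::finite \<Rightarrow> real) \<Rightarrow> real" where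
  "tri_lo a b \<beta> f = (f a - \<beta> + f (apex a b f)) / 2"

text \<open>On the hypotenuse the apex is ambiguous, but there \<open>tri_hi = tri_lo\<close>, so
  one of the first two cases applies.\<close>

definition round_k23 :: "'i \<Rightarrow> 'i \<Rightarrow> real \<Rightarrow> real \<Rightarrow> ('i::finite \<Rightarrow> real) \<Rightarrow> 'i" where
  "round_k23 a b \<beta> \<theta> f =
     (if tri_hi a b \<beta> f < \<theta> then a else if \<theta> \<le> tri_lo a b \<beta> f then b else apex a b f)"

locale k23_rounding =
  fixes a b :: "'i::finite" and \<beta> :: real
  assumes ab: "a \<noteq> b" and other: "- {a, b} \<noteq> {}" and pos: "0 < \<beta>"
    and semimetric_k23: "semimetric_on UNIV (\<lambda>i j. \<beta> * k23 a b i j)"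
begin

abbreviation X where "X \<equiv> tight_span (\<lambda>i j. \<beta> * k23 a b i j)"

lemma apex: "apex a b f \<notin> {a, b}" "i \<notin> {a, b} \<Longrightarrow> f (apex a b f) \<le> f i"
  using arg_min_if_finite[OF _ other, of f] unfolding apex_def by (auto simp: not_less)

context
  fixes f assumes f: "f \<in> X"
begin

lemma dom: "\<beta> * k23 a b i j \<le> f i + f j"
  using f by (auto simp: tight_span_def dominating_def)

lemma lip: "f i \<le> f j + \<beta> * k23 a b i j"
  using tight_span_lipschitz[OF semimetric_k23 f] .

lemma leg: "i \<notin> {a, b} \<Longrightarrow> \<beta> \<le> f a + f i" "i \<notin> {a, b} \<Longrightarrow> f a \<le> f i + \<beta>" "i \<notin> {a, b} \<Longrightarrow> f b \<le> f i + \<beta>"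
  using dom[of a i] lip[of a i] lip[of b i] by (auto simp: k23_def)

lemma other_ge: "i \<notin> {a, b} \<Longrightarrow> j \<notin> {a, b} \<Longrightarrow> i \<noteq> j \<Longrightarrow> 2 * \<beta> \<le> f i + f j"
  using dom[of i j] by (auto simp: k23_def)

text \<open>Every point lies between \<open>a\<close> and \<open>b\<close>; the upper bound comes
  from a tight partner of \<open>a\<close>.\<close>

lemma sum_ab: "f a + f b = 2 * \<beta>"
proof -
  obtain j where j: "f a + f j = \<beta> * k23 a b a j" using f by (auto simp: tight_span_def)
  have "2 * \<beta> \<le> f a + f b" using dom[of a b] ab by (simp add: k23_def)
  moreover have "f a + f b \<le> 2 * \<beta>"
  proof (cases "j \<in> {a, b}")
    case True
    then show ?thesis using j lip[of b a] ab by (auto simp: k23_def)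
  next
    case False
    then show ?thesis using j leg(3)[of j] by (auto simp: k23_def)
  qed
  ultimately show ?thesis by simp
qed

lemma apex_le: "f (apex a b f) \<le> \<beta>"
proof (rule ccontr)
  let ?i = "apex a b f"
  assume *: "\<not> f ?i \<le> \<beta>"
  obtain j where j: "f ?i + f j = \<beta> * k23 a b ?i j" using f by (auto simp: tight_span_def)
  have nonneg: "0 \<le> f j" using dom[of j j] by (simp add: k23_def)
  show False
  proof (cases "j \<in> {a, b} \<or> j = ?i")
    case True
    then show False using j nonneg * apex(1)[of f] pos by (auto simp: k23_def)
  next
    case False
    then show False using j apex(1)[of f] apex(2)[of j f] * by (auto simp: k23_def)
  qed
qed

lemma tri_bounds: "0 \<le> tri_lo a b \<beta> f" "tri_lo a b \<beta> f \<le> tri_hi a b \<beta> f" "tri_hi a b \<beta> f \<le> \<beta>"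
  using leg[OF apex(1), of f] apex_le unfolding tri_lo_def tri_hi_def by auto

text \<open>Two different values outside \<open>{a, b}\<close> sum to at least 2\<beta>, so at most
  one is below \<beta>: off the hypotenuse the triangle is determined.\<close>

lemma apex_unique: "i \<notin> {a, b} \<Longrightarrow> f i < \<beta> \<Longrightarrow> apex a b f = i"
  using other_ge[of i "apex a b f"] apex(1)[of f] apex(2)[of i f] by force

text \<open>The equation puts \<open>f\<close> on the leg from \<open>x\<close> to \<open>i\<close>.
  There \<open>tri_lo = 0\<close> if \<open>x = a\<close>, which excludes \<open>b\<close>, and
  \<open>tri_hi = \<beta>\<close> if \<open>x = b\<close>, which excludes \<open>a\<close>.\<close>

lemma round_k23_tight:
  assumes "0 < \<theta>" "\<theta> < \<beta>" "x \<in> {a, b}" "i \<notin> {a, b}" "f x + f i = \<beta>"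
  shows "round_k23 a b \<beta> \<theta> f \<in> {x, i}"
proof -
  have fi: "f i \<le> \<beta>" using assms(5) dom[of x x] by (simp add: k23_def)
  have m: "f (apex a b f) \<le> f i" using apex(2)[OF assms(4)] .
  show ?thesis
  proof (cases "f i < \<beta>")
    case True
    then have "apex a b f = i" using apex_unique assms(4) by blast
    then show ?thesis using assms(1,2,3,5) sum_ab ab unfolding round_k23_def tri_hi_def tri_lo_def
      by auto
  next
    case False
    then have fi: "f i = \<beta>" "f x = 0" using fi assms(5) by auto
    have "\<beta> \<le> f (apex a b f)" using dom[of x "apex a b f"] fi(2) assms(3) apex(1)[of f]
      by (auto simp: k23_def)
    then show ?thesis using assms(1,2,3) apex_le fi sum_ab ab unfolding round_k23_def tri_hi_def tri_lo_def
      by auto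
  qed
qed

end

lemma round_k23_row:
  assumes "0 < \<theta>" "\<theta> < \<beta>"
  shows "round_k23 a b \<beta> \<theta> (\<lambda>j. \<beta> * k23 a b t j) = t"
proof -
  let ?f = "\<lambda>j. \<beta> * k23 a b t j"
  have f: "?f \<in> X" using row_in_tight_span[OF semimetric_k23, of t] .
  show ?thesis
  proof (cases "t \<in> {a, b}")
    case True
    then have "?f (apex a b ?f) = \<beta>" using apex(1)[of ?f] by (auto simp: k23_def)
    then show ?thesis using True assms ab unfolding round_k23_def tri_hi_def tri_lo_def
      by (auto simp: k23_def)
  next
    case False
    then have "apex a b ?f = t" using apex_unique[OF f, of t] pos by (simp add: k23_def)
    then show ?thesis using False assms unfolding round_k23_def tri_hi_def tri_lo_def
      by (auto simp: k23_def)
  qed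
qed

text \<open>In a common triangle the average is the l1 distance of the coordinate pairs. Since
  \<bar>u\<bar> + \<bar>v\<bar> is the larger of \<bar>u + v\<bar> and \<bar>u - v\<bar>, this is
  the larger change at \<open>a\<close> and at the apex.\<close>

lemma round_k23_average:
  assumes f: "f \<in> X" and h: "h \<in> X" and M: "\<And>i. \<bar>f i - h i\<bar> \<le> M"
  obtains I where "((\<lambda>\<theta>. k23 a b (round_k23 a b \<beta> \<theta> f) (round_k23 a b \<beta> \<theta> h)) has_integral I) {0..\<beta>}" "I \<le> M"
proof -
  define x y x' y' where "x = tri_hi a b \<beta> f" and "y = tri_lo a b \<beta> f"
    and "x' = tri_hi a b \<beta> h" and "y' = tri_lo a b \<beta> h"
  note defs = x_def y_def x'_def y'_def
  have b: "0 \<le> y" "y \<le> x" "x \<le> \<beta>" "0 \<le> y'" "y' \<le> x'" "x' \<le> \<beta>"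
    using tri_bounds[OF f] tri_bounds[OF h] by (auto simp: defs)
  define same where "same \<longleftrightarrow> apex a b f = apex a b h"
  let ?g = "\<lambda>\<theta>. of_bool (min x x' < \<theta> \<and> \<theta> \<le> max x x') + of_bool (min y y' < \<theta> \<and> \<theta> \<le> max y y')
       + (if same then 0 else 2) * of_bool (max y y' < \<theta> \<and> \<theta> \<le> min x x') :: real"
  define I where "I = max 0 (max x x' - min x x') + max 0 (max y y' - min y y')
       + (if same then 0 else 2) * max 0 (min x x' - max y y')"
  have "(?g has_integral I) {0..\<beta>}"
    unfolding I_def
    by (intro has_integral_add has_integral_mult_right has_integral_interval) (use b in auto)
  moreover have "k23 a b (round_k23 a b \<beta> \<theta> f) (round_k23 a b \<beta> \<theta> h) = ?g \<theta>" for \<theta>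
    using b apex(1)[of f] apex(1)[of h] ab unfolding round_k23_def defs[symmetric] same_def k23_def
    by (auto simp: min_def max_def)
  moreover have "I \<le> M"
  proof (cases same)
    case True
    then show ?thesis using M[of a] M[of "apex a b f"]
      unfolding I_def defs tri_hi_def tri_lo_def same_def by (simp add: min_def max_def abs_le_iff) argo
  next
    case False
    show ?thesis
    proof (cases "max y y' \<le> min x x'")
      \<comment> \<open>The intervals from \<open>tri_lo\<close> to \<open>tri_hi\<close> meet, and
        thresholds in both send the points to different apexes at graph distance 2.\<close>
      case True
      then have "I = x + x' - y - y'" using False by (simp add: I_def min_def max_def)
      also have "\<dots> = 2 * \<beta> - f (apex a b f) - h (apex a b h)"
        unfolding defs tri_hi_def tri_lo_def by (simp add: field_simps)
      also have "\<dots> \<le> h (apex a b f) - f (apex a b f)"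
        using other_ge[OF h apex(1) apex(1), of f h] False by (auto simp: same_def)
      also have "\<dots> \<le> M" using M[of "apex a b f"] by simp
      finally show ?thesis .
    next
      \<comment> \<open>Disjoint intervals: both coordinates of one point are below those of the
        other, so the absolute values combine to the change at \<open>a\<close>.\<close>
      case nle: False
      then have "I = \<bar>x + y - x' - y'\<bar>" using False b by (auto simp: I_def min_def max_def split: if_splits)
      also have "x + y - x' - y' = f a - h a" unfolding defs tri_hi_def tri_lo_def by argo
      finally show ?thesis using M[of a] by simp
    qed
  qed
  ultimately show ?thesis using that by simp
qed

end

subsection \<open>Rounding the tight span of a five-point semimetric\<close>

locale five_point_splits = split_sequence d S
  for d :: "'i::finite \<Rightarrow> 'i \<Rightarrow> real" and S :: "nat \<Rightarrow> 'i \<times> 'i" +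
  assumes card5: "CARD('i) = 5"
    and single: "n < 5 \<Longrightarrow> fst (S n) = snd (S n)"
    and pair: "5 \<le> n \<Longrightarrow> n < 15 \<Longrightarrow> fst (S n) \<noteq> snd (S n)"
    and complete: "\<exists>n<15. side n = {p, q}"
    and inj_side: "inj_on side {..<15}"
begin

section \<open>Pairs of positive weight and the number of labels\<close>

definition core :: "nat set" where
  "core = {n. 5 \<le> n \<and> n < 15 \<and> 0 < weight n}"

definition star :: "'i \<Rightarrow> nat set" where
  "star v = {n \<in> core. v \<in> side n}"

lemma residual_prime:
  obtains a b \<beta> where "a \<noteq> b" "0 \<le> \<beta>" "\<And>i j. residual 15 i j = \<beta> * k23 a b i j"
proof (rule five_point_prime[OF card5 residual_semimetric[of 15]])
  fix p q :: 'i
  obtain n where n: "n < 15" "side n = {p, q}" using complete by blast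
  have "card {p, q} < CARD('i)" using card_length[of "[p, q]"] card5 by simp
  then have "side n \<noteq> UNIV" using n(2) by auto
  then obtain i j where ij: "i \<notin> side n" "j \<notin> side n" "gap (residual 15) (fst (S n)) (snd (S n)) i j \<le> 0"
    using resolved_residual[OF n(1)] by blast
  have "{fst (S n), snd (S n)} = {p, q}" using n(2) by (simp add: side_def)
  then have "gap (residual 15) (fst (S n)) (snd (S n)) i j = gap (residual 15) p q i j"
    using gap_commute(2)[OF residual_semimetric, of 15 p q i j] by (auto simp: doubleton_eq_iff)
  then show "\<exists>i j. i \<notin> {p, q} \<and> j \<notin> {p, q} \<and> gap (residual 15) p q i j \<le> 0"
    using ij n(2) by auto
qed (rule that)

text \<open>Let two sides \<open>{v, x}\<close> and \<open>{v, y}\<close> be in \<open>B\<close>. A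
  third core side \<open>{v, z}\<close> would give three crossing splits of
  \<open>{v, x, y, z}\<close>; so would \<open>{x, y}\<close> on \<open>{v, x, y, w}\<close>, where
  it cuts like \<open>{v, w}\<close>. Hence \<open>B\<close> consists of these two and is the full
  star of \<open>v\<close>.\<close>

lemma core_intersecting:
  assumes B: "B \<subseteq> core" and int: "\<And>m n. m \<in> B \<Longrightarrow> n \<in> B \<Longrightarrow> side m \<inter> side n \<noteq> {}"
  obtains "B = {}" | n where "n \<in> core" "B = {n}"
    | v m n where "m \<in> B" "n \<in> B" "side m \<inter> side n = {v}" "B = star v"
proof -
  consider "B = {}" | n where "B = {n}" | m n where "m \<in> B" "n \<in> B" "m \<noteq> n" by blast
  then show thesis
  proof cases
    case 1 then show thesis by (rule that(1))
  next
    case (2 n) then show thesis using B that(2)[of n] by blast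
  next
    case (3 m n)
    have doubleton: "\<exists>x. side k = {u, x} \<and> x \<noteq> u" if "k \<in> core" "u \<in> side k" for k u
    proof -
      have "fst (S k) \<noteq> snd (S k)" using that(1) pair by (simp add: core_def)
      then show ?thesis using that(2) unfolding side_def
        by (intro exI[of _ "if u = fst (S k) then snd (S k) else fst (S k)"]) auto
    qed
    have wt: "0 < weight k" if "k \<in> core" for k using that by (simp add: core_def)
    obtain v where v: "v \<in> side m" "v \<in> side n" using int 3 by blast
    have mn: "m \<in> core" "n \<in> core" using 3 B by auto
    obtain x y where x: "side m = {v, x}" "x \<noteq> v" and y: "side n = {v, y}" "y \<noteq> v"
      using doubleton mn v by metis
    have "side m \<noteq> side n" using inj_onD[OF inj_side, of m n] 3(3) mn by (auto simp: core_def)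
    then have xy: "x \<noteq> y" using x y by auto
    have "k \<in> {m, n}" if k: "k \<in> star v" for k
    proof (rule ccontr)
      assume "k \<notin> {m, n}"
      obtain z where z: "side k = {v, z}" "z \<noteq> v" using doubleton[of k v] k by (auto simp: star_def)
      have "side k \<noteq> side m" "side k \<noteq> side n"
        using inj_onD[OF inj_side, of k m] inj_onD[OF inj_side, of k n] \<open>k \<notin> {m, n}\<close> mn k
        by (auto simp: star_def core_def)
      then show False
        using not_three_splits[of m n k v x y z] wt mn k x y z xy by (auto simp: star_def)
    qed
    moreover have "v \<in> side k" if k: "k \<in> B" for k
    proof (rule ccontr)
      assume nv: "v \<notin> side k"
      have kc: "k \<in> core" using k B by auto
      have "side k \<inter> side m \<noteq> {}" "side k \<inter> side n \<noteq> {}" using int k 3 by auto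
      then have mem: "x \<in> side k" "y \<in> side k" using nv x y by auto
      then have side: "side k = {x, y}" using doubleton[OF kc mem(1)] xy by auto
      have "card {v, x, y} < CARD('i)" using card_length[of "[v, x, y]"] card5 by simp
      then have "{v, x, y} \<noteq> UNIV" by auto
      then obtain w where "w \<notin> {v, x, y}" by blast
      then show False using not_three_splits[of m n k v x y w] wt mn kc x y xy side by auto
    qed
    ultimately have "B = star v" using B 3 mn v unfolding star_def by blast
    moreover have "side m \<inter> side n = {v}" using x y xy by auto
    ultimately show thesis using that(3) 3 by blast
  qed
qed

text \<open>In the final residual the gap of \<open>a, b\<close> against two other points is
  -2\<beta>. A negative gap was already negative when split \<open>n\<close> was treated, where
  positive weight demands a positive one. So core sides are edges of the bipartite graph.\<close>

lemma core_side:
  assumes res: "\<And>i j. residual 15 i j = \<beta> * k23 a b i j" and "0 < \<beta>" "a \<noteq> b" and n: "n \<in> core"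
  obtains x i where "x \<in> {a, b}" "i \<notin> {a, b}" "side n = {x, i}"
proof -
  have neg: "gap (residual 15) p q i j < 0"
    if "{p, q} = {a, b} \<and> {i, j} \<inter> {a, b} = {} \<or> {i, j} = {a, b} \<and> {p, q} \<inter> {a, b} = {}" "p \<noteq> q" "i \<noteq> j"
    for p q i j
    using that assms(2,3) unfolding gap_def res k23_def by (auto simp: doubleton_eq_iff)
  have no: "{p, q} \<noteq> side n"
    if "{p, q} = {a, b} \<and> {i, j} \<inter> {a, b} = {} \<or> {i, j} = {a, b} \<and> {p, q} \<inter> {a, b} = {}" "p \<noteq> q" "i \<noteq> j"
    for p q i j
  proof
    assume side: "{p, q} = side n"
    have ij: "i \<notin> {p, q}" "j \<notin> {p, q}" using that(1) by auto
    have "gap (residual n) p q i j < 0"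
      using gap_residual_neg[OF ij that(2,3) _ neg[OF that]] n by (simp add: core_def)
    moreover have "gap (residual n) p q i j > 0"
      using weight_pos_gap[OF _ side[symmetric] ij] n by (simp add: core_def)
    ultimately show False by simp
  qed
  have ne: "fst (S n) \<noteq> snd (S n)" using n pair by (auto simp: core_def)
  have "card {a, b, u} < CARD('i)" for u using card_length[of "[a, b, u]"] card5 by simp
  then have ex: "\<exists>v. v \<notin> {a, b, u}" for u by (metis UNIV_eq_I less_irrefl)
  obtain i where "i \<notin> {a, b, a}" using ex by blast
  moreover obtain j where "j \<notin> {a, b, i}" using ex by blast
  ultimately have "side n \<noteq> {a, b}" using no[of a b i j] assms(3) by auto
  moreover have "\<not> {fst (S n), snd (S n)} \<inter> {a, b} = {}"
    using no[of "fst (S n)" "snd (S n)" a b] ne assms(3) by (auto simp: side_def)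
  ultimately consider "fst (S n) \<in> {a, b}" "snd (S n) \<notin> {a, b}" | "snd (S n) \<in> {a, b}" "fst (S n) \<notin> {a, b}"
    using ne unfolding side_def by blast
  then show thesis using that[of "fst (S n)" "snd (S n)"] that[of "snd (S n)" "fst (S n)"]
    by cases (auto simp: side_def)
qed

text \<open>The vertex is free for empty \<open>B\<close> (5 labels), one of two for a single edge
  (6 * 2 labels), and the centre for a star arising from two edges (5 labels).\<close>

lemma card_core_labels:
  assumes \<kappa>: "\<And>B \<kappa> n. (B, \<kappa>) \<in> L \<Longrightarrow> n \<in> B \<Longrightarrow> \<kappa> \<in> side n"
    and L: "\<And>B \<kappa>. (B, \<kappa>) \<in> L \<Longrightarrow> B \<subseteq> core"
      "\<And>B \<kappa> m n. (B, \<kappa>) \<in> L \<Longrightarrow> m \<in> B \<Longrightarrow> n \<in> B \<Longrightarrow> side m \<inter> side n \<noteq> {}"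
    and bip: "\<And>n. n \<in> core \<Longrightarrow> \<exists>x i. x \<in> {a, b} \<and> i \<notin> {a, b} \<and> side n = {x, i}"
    and ab: "a \<noteq> b"
  shows "card L \<le> 25"
proof -
  have fin: "finite core" by (simp add: core_def)
  have sub: "side ` core \<subseteq> (\<lambda>(x, i). {x, i}) ` ({a, b} \<times> (- {a, b}))"
  proof
    fix A assume "A \<in> side ` core"
    then obtain n where "n \<in> core" "A = side n" by auto
    then obtain x i where "x \<in> {a, b}" "i \<in> - {a, b}" "A = {x, i}" using bip[of n] by auto
    then show "A \<in> (\<lambda>(x, i). {x, i}) ` ({a, b} \<times> (- {a, b}))" by blast
  qed
  have "card core = card (side ` core)"
    by (rule card_image[symmetric], rule inj_on_subset[OF inj_side]) (auto simp: core_def)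
  also have "\<dots> \<le> card ({a, b} \<times> (- {a, b}))"
    by (rule order_trans[OF card_mono[OF _ sub] card_image_le]) auto
  also have "\<dots> = 6" using card5 ab by (simp add: card_cartesian_product Compl_eq_Diff_UNIV card_Diff_subset)
  finally have core6: "card core \<le> 6" .
  have side2: "card (side n) \<le> 2" for n using card_length[of "[fst (S n), snd (S n)]"] by (simp add: side_def)
  define L1 where "L1 = (\<lambda>(n, \<kappa>). ({n}, \<kappa>)) ` (Sigma core side)"
  have "card (Sigma core side) = (\<Sum>n\<in>core. card (side n))" using fin by (simp add: card_SigmaI)
  also have "\<dots> \<le> card core * 2" using side2 sum_bounded_above[of core "\<lambda>n. card (side n)" 2] by simp
  finally have "card L1 \<le> 12"
    using card_image_le[of "Sigma core side" "\<lambda>(n, \<kappa>). ({n}, \<kappa>)"] fin core6 unfolding L1_def by simp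
  moreover have "card ((\<lambda>v. (star v, v)) ` UNIV) \<le> 5" using card_image_le[of UNIV "\<lambda>v. (star v, v)"] card5 by simp
  moreover have "card ((\<lambda>v. ({} :: nat set, v)) ` (UNIV :: 'i set)) \<le> 5"
    using card_image_le[of UNIV "\<lambda>v::'i. ({} :: nat set, v)"] card5 by simp
  moreover have "L \<subseteq> ((\<lambda>v. ({}, v)) ` UNIV \<union> L1) \<union> (\<lambda>v. (star v, v)) ` UNIV"
  proof
    fix l assume l: "l \<in> L"
    obtain B \<kappa> where B: "l = (B, \<kappa>)" by force
    note l = l[unfolded B]
    show "l \<in> ((\<lambda>v. ({}, v)) ` UNIV \<union> L1) \<union> (\<lambda>v. (star v, v)) ` UNIV"
    proof (rule core_intersecting[OF L(1)[OF l] L(2)[OF l]])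
      assume "B = {}" then show ?thesis using B by auto
    next
      fix n assume "n \<in> core" "B = {n}"
      then have "(n, \<kappa>) \<in> Sigma core side" using assms(1)[OF l, of n] by auto
      then show ?thesis using B \<open>B = {n}\<close> unfolding L1_def by force
    next
      fix v m n assume *: "m \<in> B" "n \<in> B" "side m \<inter> side n = {v}" "B = star v"
      then have "\<kappa> = v" using assms(1)[OF l] by blast
      then show ?thesis using B * by auto
    qed auto
  qed
  moreover have "finite L1" using fin unfolding L1_def by auto
  ultimately show ?thesis
    using card_mono[of "((\<lambda>v. ({}, v)) ` UNIV \<union> L1) \<union> (\<lambda>v. (star v, v)) ` UNIV" L]
      card_Un_le[of "(\<lambda>v. ({}, v)) ` UNIV \<union> L1" "(\<lambda>v. (star v, v)) ` UNIV"]
      card_Un_le[of "(\<lambda>v. ({}, v)) ` UNIV" L1] by simp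
qed

text \<open>Counts the labels when the final residual vanishes; then all ten pairs may have positive
  weight.\<close>

lemma card_core_labels_const:
  assumes L: "\<And>B \<kappa>. (B, \<kappa>) \<in> L \<Longrightarrow> B \<subseteq> core"
      "\<And>B \<kappa> m n. (B, \<kappa>) \<in> L \<Longrightarrow> m \<in> B \<Longrightarrow> n \<in> B \<Longrightarrow> side m \<inter> side n \<noteq> {}"
    and const: "\<And>B \<kappa>. (B, \<kappa>) \<in> L \<Longrightarrow> \<kappa> = a"
  shows "card L \<le> 25"
proof -
  let ?U = "{({}, a)} \<union> (\<lambda>n. ({n}, a)) ` {5..<15} \<union> (\<lambda>v. (star v, a)) ` UNIV"
  have "L \<subseteq> ?U"
  proof
    fix l assume l: "l \<in> L"
    obtain B \<kappa> where B: "l = (B, \<kappa>)" by force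
    note l = l[unfolded B]
    have \<kappa>: "\<kappa> = a" using const[OF l] .
    show "l \<in> ?U"
      by (rule core_intersecting[OF L(1)[OF l] L(2)[OF l]]) (auto simp: B \<kappa> core_def)
  qed
  then have "card L \<le> card ?U" by (intro card_mono) auto
  also have "\<dots> \<le> card {({} :: nat set, a)} + card ((\<lambda>n. ({n}, a)) ` {5..<15::nat}) + card ((\<lambda>v. (star v, a)) ` UNIV)"
    by (intro order_trans[OF card_Un_le] add_right_mono card_Un_le)
  also have "\<dots> \<le> 1 + 10 + 5"
    using card_image_le[of "{5..<15::nat}" "\<lambda>n. ({n}, a)"] card_image_le[of UNIV "\<lambda>v. (star v, a)"] card5
    by (intro add_mono) auto
  finally show ?thesis by simp
qed

end

section \<open>Choice of the thresholds and the rounded semimetric\<close>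

context five_point_splits
begin

text \<open>A uniform threshold separates two coordinates with probability proportional to their
  difference; one threshold serves the whole weighted sum.\<close>

lemma threshold:
  fixes c :: "'e \<Rightarrow> real"
  assumes E: "finite E" "\<And>e. e \<in> E \<Longrightarrow> 0 \<le> c e"
    and fh: "\<And>e. e \<in> E \<Longrightarrow> f e \<in> tight_span d" "\<And>e. e \<in> E \<Longrightarrow> h e \<in> tight_span d"
  shows "\<exists>\<tau>. (0 < weight n \<longrightarrow> 0 < \<tau> \<and> \<tau> < weight n) \<and>
    (\<Sum>e\<in>E. c e * (weight n * of_bool ((coord n (f e) < \<tau>) \<noteq> (coord n (h e) < \<tau>))))
      \<le> (\<Sum>e\<in>E. c e * \<bar>coord n (f e) - coord n (h e)\<bar>)"
proof (cases "weight n = 0")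
  case True
  \<comment> \<open>The left side vanishes with the weight; 0 is an arbitrary value.\<close>
  then show ?thesis using E by (intro exI[of _ 0]) (simp add: sum_nonneg)
next
  case False
  then have pos: "0 < weight n" using weight_nonneg[of n] by simp
  define x y where "x e = coord n (f e)" and "y e = coord n (h e)" for e
  define g where "g \<theta> = (\<Sum>e\<in>E. c e * of_bool ((x e < \<theta>) \<noteq> (y e < \<theta>)))" for \<theta>
  have g_int: "(g has_integral (\<Sum>e\<in>E. c e * \<bar>x e - y e\<bar>)) {0..weight n}"
    unfolding g_def
  proof (intro has_integral_sum E(1) has_integral_mult_right)
    fix e assume e: "e \<in> E"
    have "((\<lambda>\<theta>. of_bool (min (x e) (y e) < \<theta> \<and> \<theta> \<le> max (x e) (y e))) has_integral
        max 0 (max (x e) (y e) - min (x e) (y e))) {0..weight n}"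
      using coord_bounds[OF fh(1)[OF e], of n] coord_bounds[OF fh(2)[OF e], of n]
      by (intro has_integral_interval) (auto simp: x_def y_def)
    moreover have "(\<lambda>\<theta>. of_bool ((x e < \<theta>) \<noteq> (y e < \<theta>))) =
        (\<lambda>\<theta>. of_bool (min (x e) (y e) < \<theta> \<and> \<theta> \<le> max (x e) (y e)) :: real)"
      by (auto simp: fun_eq_iff min_def max_def)
    moreover have "max 0 (max (x e) (y e) - min (x e) (y e)) = \<bar>x e - y e\<bar>" by auto
    ultimately show "((\<lambda>\<theta>. of_bool ((x e < \<theta>) \<noteq> (y e < \<theta>))) has_integral \<bar>x e - y e\<bar>) {0..weight n}"
      by simp
  qed
  have g_nonneg: "0 \<le> g \<theta>" for \<theta> unfolding g_def using E by (intro sum_nonneg) auto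
  obtain \<tau> where "0 < \<tau>" "\<tau> < weight n" "weight n * g \<tau> \<le> (\<Sum>e\<in>E. c e * \<bar>x e - y e\<bar>)"
    by (rule exists_le_average[OF pos g_int g_nonneg])
  then show ?thesis
    by (intro exI[of _ \<tau>]) (simp add: g_def x_def y_def sum_distrib_left mult.left_commute)
qed

text \<open>Separates the choice of \<kappa> from the count: the tight sides at a preimage
  \<open>f\<close> of \<open>v\<close> are what forces \<open>v\<close> onto every side in
  \<open>B\<close>.\<close>

definition rounded_labels :: "(('i \<Rightarrow> real) \<Rightarrow> 'i) \<Rightarrow> (nat set \<times> 'i) set \<Rightarrow> bool" where
  "rounded_labels \<kappa> L \<longleftrightarrow> (\<forall>(B, v) \<in> L. B \<subseteq> core \<and> (\<forall>m\<in>B. \<forall>n\<in>B. side m \<inter> side n \<noteq> {}) \<and>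
     (\<exists>f\<in>tight_span (residual 15). v = \<kappa> f \<and>
        (\<forall>n\<in>B. f (fst (S n)) + f (snd (S n)) = residual 15 (fst (S n)) (snd (S n)))))"

text \<open>The first conclusion compares distances rather than vertices, because for \<beta> = 0
  all rows coincide and \<kappa> is constant.\<close>

lemma prime_rounding:
  fixes c M :: "'e \<Rightarrow> real"
  assumes E: "finite E" "\<And>e. e \<in> E \<Longrightarrow> 0 \<le> c e"
    and fh: "\<And>e. e \<in> E \<Longrightarrow> f e \<in> tight_span (residual 15)" "\<And>e. e \<in> E \<Longrightarrow> h e \<in> tight_span (residual 15)"
    and M: "\<And>e i. e \<in> E \<Longrightarrow> \<bar>f e i - h e i\<bar> \<le> M e"
  obtains \<kappa> where "\<And>s t. residual 15 (\<kappa> (residual 15 s)) (\<kappa> (residual 15 t)) = residual 15 s t"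
    and "(\<Sum>e\<in>E. c e * residual 15 (\<kappa> (f e)) (\<kappa> (h e))) \<le> (\<Sum>e\<in>E. c e * M e)"
    and "\<And>L. rounded_labels \<kappa> L \<Longrightarrow> card L \<le> 25"
proof -
  obtain a b \<beta> where ab: "a \<noteq> b" and \<beta>: "0 \<le> \<beta>" and res: "\<And>i j. residual 15 i j = \<beta> * k23 a b i j"
    using residual_prime by blast
  show thesis
  proof (cases "\<beta> = 0")
    case True
    have M0: "0 \<le> M e" if "e \<in> E" for e using M[OF that, of a] by simp
    show thesis
    proof (rule that[of "\<lambda>_. a"])
      show "(\<Sum>e\<in>E. c e * residual 15 a a) \<le> (\<Sum>e\<in>E. c e * M e)"
        using True E(2) M0 by (simp add: res sum_nonneg)
      show "card L \<le> 25" if "rounded_labels (\<lambda>_. a) L" for L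
        by (rule card_core_labels_const[of L a]) (use that in \<open>fastforce simp: rounded_labels_def\<close>)+
    qed (simp add: res True)
  next
    case False
    then have pos: "0 < \<beta>" using \<beta> by simp
    have res': "residual 15 = (\<lambda>i j. \<beta> * k23 a b i j)" by (simp add: res fun_eq_iff)
    have "card {a, b} < CARD('i)" using card_length[of "[a, b]"] card5 by simp
    then have other: "- {a, b} \<noteq> {}" by (metis Compl_empty_eq double_complement less_irrefl)
    have "semimetric_on UNIV (\<lambda>i j. \<beta> * k23 a b i j)"
      using residual_semimetric[of 15] by (simp only: res')
    then interpret k23_rounding a b \<beta> by (rule k23_rounding.intro[OF ab other pos])
    have "\<exists>I. \<forall>e\<in>E. ((\<lambda>\<theta>. k23 a b (round_k23 a b \<beta> \<theta> (f e)) (round_k23 a b \<beta> \<theta> (h e))) has_integral I e) {0..\<beta>}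
        \<and> I e \<le> M e"
    proof (intro bchoice ballI)
      fix e assume e: "e \<in> E"
      have *: "f e \<in> X" "h e \<in> X" using fh[OF e] by (simp_all only: res')
      obtain I where "((\<lambda>\<theta>. k23 a b (round_k23 a b \<beta> \<theta> (f e)) (round_k23 a b \<beta> \<theta> (h e))) has_integral I) {0..\<beta>}"
          "I \<le> M e"
        by (rule round_k23_average[OF * M[OF e]])
      then show "\<exists>I. ((\<lambda>\<theta>. k23 a b (round_k23 a b \<beta> \<theta> (f e)) (round_k23 a b \<beta> \<theta> (h e))) has_integral I) {0..\<beta>} \<and> I \<le> M e"
        by blast
    qed
    then obtain I where I: "\<And>e. e \<in> E \<Longrightarrow>
        ((\<lambda>\<theta>. k23 a b (round_k23 a b \<beta> \<theta> (f e)) (round_k23 a b \<beta> \<theta> (h e))) has_integral I e) {0..\<beta>}"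
      "\<And>e. e \<in> E \<Longrightarrow> I e \<le> M e" by blast
    define g where "g \<theta> = (\<Sum>e\<in>E. c e * k23 a b (round_k23 a b \<beta> \<theta> (f e)) (round_k23 a b \<beta> \<theta> (h e)))" for \<theta>
    have g_int: "(g has_integral (\<Sum>e\<in>E. c e * I e)) {0..\<beta>}"
      unfolding g_def by (intro has_integral_sum E(1) has_integral_mult_right I(1))
    have g_nonneg: "0 \<le> g \<theta>" for \<theta> unfolding g_def
      using E by (intro sum_nonneg mult_nonneg_nonneg) (auto simp: k23_def)
    obtain \<theta> where \<theta>: "0 < \<theta>" "\<theta> < \<beta>" "\<beta> * g \<theta> \<le> (\<Sum>e\<in>E. c e * I e)"
      by (rule exists_le_average[OF pos g_int g_nonneg])
    show thesis
    proof (rule that[of "round_k23 a b \<beta> \<theta>"])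
      show "residual 15 (round_k23 a b \<beta> \<theta> (residual 15 s)) (round_k23 a b \<beta> \<theta> (residual 15 t)) = residual 15 s t" for s t
        unfolding res' round_k23_row[OF \<theta>(1,2)] ..
      have "(\<Sum>e\<in>E. c e * residual 15 (round_k23 a b \<beta> \<theta> (f e)) (round_k23 a b \<beta> \<theta> (h e))) = \<beta> * g \<theta>"
        by (simp add: g_def res sum_distrib_left mult.left_commute)
      also have "\<dots> \<le> (\<Sum>e\<in>E. c e * M e)"
        using \<theta>(3) by (rule order_trans) (intro sum_mono mult_left_mono I(2) E(2))
      finally show "(\<Sum>e\<in>E. c e * residual 15 (round_k23 a b \<beta> \<theta> (f e)) (round_k23 a b \<beta> \<theta> (h e)))
        \<le> (\<Sum>e\<in>E. c e * M e)" .
      fix L assume "rounded_labels (round_k23 a b \<beta> \<theta>) L"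
      then have L: "B \<subseteq> core" "m \<in> B \<Longrightarrow> n \<in> B \<Longrightarrow> side m \<inter> side n \<noteq> {}"
        "\<exists>f\<in>tight_span (residual 15). v = round_k23 a b \<beta> \<theta> f \<and>
          (\<forall>n\<in>B. f (fst (S n)) + f (snd (S n)) = residual 15 (fst (S n)) (snd (S n)))"
        if "(B, v) \<in> L" for B v m n using that unfolding rounded_labels_def by fast+
      show "card L \<le> 25"
      proof (rule card_core_labels[OF _ L(1,2) _ ab])
        fix n assume "n \<in> core"
        then show "\<exists>x i. x \<in> {a, b} \<and> i \<notin> {a, b} \<and> side n = {x, i}"
          using core_side[OF res pos ab] by metis
      next
        fix B v n assume Bv: "(B, v) \<in> L" and n: "n \<in> B"
        have "n \<in> core" using L(1)[OF Bv] n by blast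
        then obtain x i where xi: "x \<in> {a, b}" "i \<notin> {a, b}" "side n = {x, i}"
          by (rule core_side[OF res pos ab])
        obtain f where f: "f \<in> X" "v = round_k23 a b \<beta> \<theta> f"
          "f (fst (S n)) + f (snd (S n)) = residual 15 (fst (S n)) (snd (S n))"
          using L(3)[OF Bv, unfolded res'] n unfolding res' by auto
        have "f x + f i = \<beta>" using f(3) xi unfolding side_def res
          by (auto simp: doubleton_eq_iff k23_def)
        then show "v \<in> side n" using round_k23_tight[OF f(1) \<theta>(1,2) xi(1,2)] f(2) xi(3) by simp
      qed
    qed
  qed
qed

end

context five_point_splits
begin

lemma rounding:
  fixes c M :: "'e \<Rightarrow> real"
  assumes E: "finite E" "\<And>e. e \<in> E \<Longrightarrow> 0 \<le> c e"
    and fh: "\<And>e. e \<in> E \<Longrightarrow> f e \<in> tight_span d" "\<And>e. e \<in> E \<Longrightarrow> h e \<in> tight_span d"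
    and M: "\<And>e i. e \<in> E \<Longrightarrow> \<bar>f e i - h e i\<bar> \<le> M e"
  shows "\<exists>\<mu> (label :: ('i \<Rightarrow> real) \<Rightarrow> 'i + nat set \<times> 'i).
    semimetric_on UNIV \<mu> \<and> (\<forall>s t. \<mu> (d s) (d t) = d s t) \<and>
    (\<Sum>e\<in>E. c e * \<mu> (f e) (h e)) \<le> (\<Sum>e\<in>E. c e * M e) \<and>
    (\<forall>g\<in>tight_span d. \<forall>p. label g = Inl p \<longrightarrow> \<mu> g (d p) = 0) \<and>
    (\<forall>g\<in>tight_span d. \<forall>g'\<in>tight_span d. \<forall>l. label g = Inr l \<longrightarrow> label g' = Inr l \<longrightarrow> \<mu> g g' = 0) \<and>
    finite {l. Inr l \<in> label ` tight_span d} \<and> card {l. Inr l \<in> label ` tight_span d} \<le> 25"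
proof -
  define Q where "Q n \<tau> \<longleftrightarrow> (0 < weight n \<longrightarrow> 0 < \<tau> \<and> \<tau> < weight n) \<and>
    (\<Sum>e\<in>E. c e * (weight n * of_bool ((coord n (f e) < \<tau>) \<noteq> (coord n (h e) < \<tau>))))
      \<le> (\<Sum>e\<in>E. c e * \<bar>coord n (f e) - coord n (h e)\<bar>)" for n \<tau>
  have "\<forall>n. \<exists>\<tau>. Q n \<tau>" unfolding Q_def by (intro allI threshold E fh)
  then obtain \<tau> where Q: "\<And>n. Q n (\<tau> n)" by metis
  have \<tau>: "0 < \<tau> n \<and> \<tau> n < weight n" if "0 < weight n" for n using Q that by (simp add: Q_def)
  have \<tau>_cost: "(\<Sum>e\<in>E. c e * (weight n * of_bool ((coord n (f e) < \<tau> n) \<noteq> (coord n (h e) < \<tau> n))))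
      \<le> (\<Sum>e\<in>E. c e * \<bar>coord n (f e) - coord n (h e)\<bar>)" for n using Q[of n] by (simp add: Q_def)
  define on where "on n g \<longleftrightarrow> coord n g < \<tau> n" for n g
  \<comment> \<open>The contractions leave this much of \<open>M e\<close> for the bipartite part;
    the thresholds spend the subtracted variation.\<close>
  define R where "R e = M e - (\<Sum>n<15. \<bar>coord n (f e) - coord n (h e)\<bar>)" for e
  have f15: "contracted 15 (f e) \<in> tight_span (residual 15)" if "e \<in> E" for e
    using contracted_tight_span[OF fh(1)[OF that]] .
  have h15: "contracted 15 (h e) \<in> tight_span (residual 15)" if "e \<in> E" for e
    using contracted_tight_span[OF fh(2)[OF that]] .
  have R: "\<bar>contracted 15 (f e) i - contracted 15 (h e) i\<bar> \<le> R e" if "e \<in> E" for e i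
    unfolding R_def using contracted_lipschitz[OF fh(1)[OF that] fh(2)[OF that] M[OF that]] .
  obtain \<kappa> where \<kappa>_row: "\<And>s t. residual 15 (\<kappa> (residual 15 s)) (\<kappa> (residual 15 t)) = residual 15 s t"
    and \<kappa>_cost: "(\<Sum>e\<in>E. c e * residual 15 (\<kappa> (contracted 15 (f e))) (\<kappa> (contracted 15 (h e)))) \<le> (\<Sum>e\<in>E. c e * R e)"
    and \<kappa>_card: "\<And>L. rounded_labels \<kappa> L \<Longrightarrow> card L \<le> 25"
    by (rule prime_rounding[of E c "\<lambda>e. contracted 15 (f e)" "\<lambda>e. contracted 15 (h e)" R, OF E f15 h15 R])
      (assumption | (rule that; blast))+
  define \<mu> where "\<mu> g g' = (\<Sum>n<15. weight n * of_bool (on n g \<noteq> on n g'))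
      + residual 15 (\<kappa> (contracted 15 g)) (\<kappa> (contracted 15 g'))" for g g'
  define B where "B g = {n \<in> core. on n g}" for g
  \<comment> \<open>Rounded to the small side of a singleton split, a point has \<mu>-distance 0 to
    that terminal and takes its label. Splits of weight 0 do not affect \<mu>, so labels record only
    those of positive weight.\<close>
  define leaf where "leaf g n \<longleftrightarrow> n < 5 \<and> 0 < weight n \<and> on n g" for g n
  define label where "label g = (if \<exists>n. leaf g n then Inl (fst (S (SOME n. leaf g n)))
      else Inr (B g, \<kappa> (contracted 15 g)))" for g
  have on_less: "coord n g < weight n" if "on n g" "0 < weight n" for n g
    using that \<tau>[of n] by (auto simp: on_def)
  have on_row: "on n (d t) \<longleftrightarrow> t \<in> side n" if "0 < weight n" for n t
    using \<tau>[OF that] by (auto simp: on_def coord_row)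

  have "semimetric_on UNIV \<mu>"
  proof -
    note res = semimetric_onD[OF residual_semimetric[of 15]]
    have "0 \<le> \<mu> g g'" for g g' unfolding \<mu>_def
      using weight_nonneg res(1) by (intro add_nonneg_nonneg sum_nonneg) auto
    moreover have "\<mu> g g = 0" for g unfolding \<mu>_def using res(2) by simp
    moreover have "\<mu> g g' = \<mu> g' g" for g g' unfolding \<mu>_def using res(3)
      by (intro arg_cong2[where f = "(+)"] sum.cong) auto
    moreover have "\<mu> x z \<le> \<mu> x y + \<mu> y z" for x y z
    proof -
      have "(\<Sum>n<15. weight n * of_bool (on n x \<noteq> on n z)) \<le>
          (\<Sum>n<15. weight n * of_bool (on n x \<noteq> on n y) + weight n * of_bool (on n y \<noteq> on n z))"
        using weight_nonneg by (intro sum_mono) auto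
      moreover have "residual 15 (\<kappa> (contracted 15 x)) (\<kappa> (contracted 15 z)) \<le>
        residual 15 (\<kappa> (contracted 15 x)) (\<kappa> (contracted 15 y)) + residual 15 (\<kappa> (contracted 15 y)) (\<kappa> (contracted 15 z))"
        by (rule res(4)) auto
      ultimately show ?thesis unfolding \<mu>_def sum.distrib by linarith
    qed
    ultimately show ?thesis unfolding semimetric_on_def by blast
  qed
  moreover have "\<mu> (d s) (d t) = d s t" for s t
  proof -
    have "weight n * of_bool (on n (d s) \<noteq> on n (d t)) = (if (s \<in> side n) \<noteq> (t \<in> side n) then weight n else 0)" for n
      using on_row[of n] weight_nonneg[of n] by (cases "weight n = 0") auto
    then show ?thesis unfolding \<mu>_def contracted_row \<kappa>_row residual_decomposition[of s t 15] by simp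
  qed
  moreover have "(\<Sum>e\<in>E. c e * \<mu> (f e) (h e)) \<le> (\<Sum>e\<in>E. c e * M e)"
  proof -
    have "(\<Sum>e\<in>E. c e * (\<Sum>n<15. weight n * of_bool (on n (f e) \<noteq> on n (h e)))) =
        (\<Sum>n<15. \<Sum>e\<in>E. c e * (weight n * of_bool (on n (f e) \<noteq> on n (h e))))"
      unfolding sum_distrib_left by (rule sum.swap)
    also have "\<dots> \<le> (\<Sum>n<15. \<Sum>e\<in>E. c e * \<bar>coord n (f e) - coord n (h e)\<bar>)"
      unfolding on_def by (intro sum_mono \<tau>_cost)
    also have "\<dots> = (\<Sum>e\<in>E. c e * (\<Sum>n<15. \<bar>coord n (f e) - coord n (h e)\<bar>))"
      unfolding sum_distrib_left by (rule sum.swap)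
    finally show ?thesis using \<kappa>_cost
      unfolding \<mu>_def R_def distrib_left right_diff_distrib sum.distrib sum_subtractf by linarith
  qed
  moreover have "\<mu> g (d p) = 0" if g: "g \<in> tight_span d" and lab: "label g = Inl p" for g p
  proof -
    have "\<exists>n. leaf g n" using lab by (auto simp: label_def split: if_splits)
    then obtain n where n: "leaf g n" "p = fst (S n)" using lab someI_ex[of "leaf g"] by (auto simp: label_def)
    have n5: "n < 5" and wn: "0 < weight n" and on_n: "on n g" using n(1) by (auto simp: leaf_def)
    have Sn: "S n = (p, p)" "side n = {p}" using single[OF n5] n(2) by (auto simp: side_def prod_eq_iff)
    have less: "coord n g < weight n" using on_less on_n wn by blast
    \<comment> \<open>Other singletons are disjoint from \<open>{p}\<close>; at the pairs
      \<open>g\<close> has already collapsed onto the row of \<open>p\<close>.\<close>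
    have eq: "on k g \<longleftrightarrow> on k (d p)" if k: "k < 15" for k
    proof -
      consider "k = n" | "k < 5" "k \<noteq> n" | "5 \<le> k" by linarith
      then show ?thesis
      proof cases
        case 1 then show ?thesis using on_n on_row[OF wn] Sn by simp
      next
        case 2
        have "side k \<noteq> side n" using inj_onD[OF inj_side, of k n] 2 n5 by auto
        moreover have "side k = {fst (S k)}" using single[OF 2(1)] by (simp add: side_def)
        ultimately have "side n \<inter> side k = {}" "p \<notin> side k" using Sn(2) by auto
        then show ?thesis using coord_disjoint[OF g less] by (simp add: on_def coord_row)
      next
        case 3
        then have "contracted k g = contracted k (d p)"
          using contracted_eq_row[OF g less Sn(1)] n5 by (simp add: contracted_row)
        then show ?thesis by (simp add: on_def coord_def)
      qed
    qed
    have "contracted 15 g = contracted 15 (d p)"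
      using contracted_eq_row[OF g less Sn(1)] n5 by (simp add: contracted_row)
    then show ?thesis unfolding \<mu>_def using eq semimetric_onD(2)[OF residual_semimetric] by simp
  qed
  moreover have "\<mu> g g' = 0" if lab: "label g = Inr l" "label g' = Inr l" for g g' l
  proof -
    have no: "\<not> leaf g n" "\<not> leaf g' n" for n using lab by (auto simp: label_def split: if_splits)
    have eq: "B g = B g'" "\<kappa> (contracted 15 g) = \<kappa> (contracted 15 g')"
      using lab by (auto simp: label_def split: if_splits)
    have "weight n * of_bool (on n g \<noteq> on n g') = 0" if "n < 15" for n
    proof (cases "0 < weight n")
      case True
      have "n \<in> B g \<longleftrightarrow> n \<in> B g'" using eq(1) by (rule arg_cong)
      then have "on n g \<longleftrightarrow> on n g'" using no[of n] True that
        by (cases "n < 5") (simp_all add: leaf_def B_def core_def)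
      then show ?thesis by simp
    qed (use weight_nonneg[of n] in simp)
    then have "(\<Sum>n<15. weight n * of_bool (on n g \<noteq> on n g')) = 0" by (intro sum.neutral) simp
    then show ?thesis unfolding \<mu>_def eq(2) using semimetric_onD(2)[OF residual_semimetric UNIV_I UNIV_I] by (simp only: add_0)
  qed
  moreover have "finite {l. Inr l \<in> label ` tight_span d}"
  proof (rule finite_subset)
    show "{l. Inr l \<in> label ` tight_span d} \<subseteq> Pow core \<times> UNIV" by (auto simp: label_def B_def split: if_splits)
  qed (simp add: core_def)
  moreover have "card {l. Inr l \<in> label ` tight_span d} \<le> 25"
  proof (rule \<kappa>_card, unfold rounded_labels_def, intro ballI, clarify)
    fix A v g assume "Inr (A, v) = label g" and g: "g \<in> tight_span d"
    then have A: "A = B g" and v: "v = \<kappa> (contracted 15 g)"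
      by (auto simp: label_def split: if_splits)
    have less: "coord n g < weight n" "n < 15" if "n \<in> A" for n
      using that on_less A by (auto simp: B_def core_def)
    have "side m \<inter> side n \<noteq> {}" if "m \<in> A" "n \<in> A" for m n
      using coord_disjoint[OF g less(1)[OF that(1)], of n] less(1)[OF that(2)] by auto
    moreover have "A \<subseteq> core" using A by (auto simp: B_def)
    ultimately show "A \<subseteq> core \<and> (\<forall>m\<in>A. \<forall>n\<in>A. side m \<inter> side n \<noteq> {}) \<and>
      (\<exists>f\<in>tight_span (residual 15). v = \<kappa> f \<and>
        (\<forall>n\<in>A. f (fst (S n)) + f (snd (S n)) = residual 15 (fst (S n)) (snd (S n))))"
      using contracted_tight_span[OF g] v contracted_tight_side[OF g less] by blast
  qed
  ultimately show ?thesis by blast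
qed

end

lemma five_point_splits_exist:
  fixes d :: "'i::finite \<Rightarrow> 'i \<Rightarrow> real"
  assumes card: "CARD('i) = 5" and d: "semimetric_on UNIV d"
  obtains S where "five_point_splits d S"
proof -
  obtain xs :: "'i list" where xs: "set xs = UNIV" "distinct xs"
    using finite_distinct_list[OF finite] by blast
  then have "length xs = 5" using distinct_card[of xs] card by simp
  then obtain a b c e f where "xs = [a, b, c, e, f]"
    by (auto simp: eval_nat_numeral length_Suc_conv)
  with xs have U: "UNIV = {a, b, c, e, f}" and dist: "distinct [a, b, c, e, f]" by auto
  let ?L = "[(a, a), (b, b), (c, c), (e, e), (f, f), (a, b), (a, c), (a, e), (a, f),
    (b, c), (b, e), (b, f), (c, e), (c, f), (e, f)]"
  define S where "S n = ?L ! n" for n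
  interpret split_sequence d S by unfold_locales (rule d)
  let ?sides = "map (\<lambda>(p, q). {p, q}) ?L"
  have side_nth: "side n = ?sides ! n" if "n < 15" for n
    using that nth_map[of n ?L "\<lambda>(p, q). {p, q}"] unfolding side_def S_def
    by (simp add: case_prod_beta del: list.map nth_Cons_numeral)
  have "five_point_splits d S"
  proof unfold_locales
    show "CARD('i) = 5" by (rule card)
    show "fst (S n) = snd (S n)" if "n < 5" for n
    proof -
      have "n \<in> {0, 1, 2, 3, 4}" using that by auto
      then show ?thesis by (auto simp: S_def)
    qed
    show "fst (S n) \<noteq> snd (S n)" if "5 \<le> n" "n < 15" for n
    proof -
      have "n \<in> {5, 6, 7, 8, 9, 10, 11, 12, 13, 14}" using that by (simp; presburger)
      then show ?thesis using dist by (auto simp: S_def)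
    qed
    show "\<exists>n<15. side n = {p, q}" for p q
    proof -
      have "p \<in> {a, b, c, e, f}" "q \<in> {a, b, c, e, f}" using U by auto
      then have "{p, q} \<in> set ?sides" by (elim insertE emptyE) (simp_all add: doubleton_eq_iff)
      then obtain n where n: "n < length ?sides" "?sides ! n = {p, q}" by (auto simp only: in_set_conv_nth)
      then have "n < 15" by simp
      then show ?thesis using side_nth n(2) by metis
    qed
    have "distinct ?sides" using dist by (simp add: doubleton_eq_iff insert_eq_iff; blast)
    then have "inj_on (\<lambda>n. ?sides ! n) {..<15}" by (intro inj_on_nth) auto
    moreover have "inj_on side {..<15} \<longleftrightarrow> inj_on (\<lambda>n. ?sides ! n) {..<15}"
      by (rule inj_on_cong) (rule side_nth, simp only: lessThan_iff)
    ultimately show "inj_on side {..<15}" by (simp only:)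
  qed
  then show thesis by (rule that)
qed

subsection \<open>Shortest-path distances\<close>

lemma walk_join:
  assumes "walk V E p" "walk V E q" "last p = hd q"
  shows "walk V E (p @ tl q) \<and> hd (p @ tl q) = hd p \<and> last (p @ tl q) = last q
    \<and> walk_length l (p @ tl q) = walk_length l p + walk_length l q"
  using assms
proof (induction V E p rule: walk.induct)
  case (2 V E u)
  then obtain q' where "q = u # q'" by (cases q) auto
  with 2 show ?case by (cases q') auto
next
  case (3 V E u v p)
  then show ?case by auto
qed simp

lemma walk_rev:
  assumes "walk V E p"
  shows "walk V E (rev p) \<and> walk_length l (rev p) = walk_length l p"
  using assms
proof (induction V E p rule: walk.induct)
  case (3 V E u v p)
  then have IH: "walk V E (rev (v # p))" "walk_length l (rev (v # p)) = walk_length l (v # p)" by auto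
  have "v \<in> V" using 3(2) by (cases p) auto
  then have vu: "walk V E [v, u]" using 3(2) by (simp add: insert_commute)
  have "walk V E (rev (v # p) @ tl [v, u]) \<and>
      walk_length l (rev (v # p) @ tl [v, u]) = walk_length l (rev (v # p)) + walk_length l [v, u]"
    using walk_join[OF IH(1) vu, of l] by simp
  then show ?case using IH(2) by (simp add: insert_commute)
qed simp_all

lemma walk_length_nonneg:
  assumes "walk V E p" "\<forall>e\<in>E. 0 \<le> l e" shows "0 \<le> walk_length l p"
  using assms by (induction V E p rule: walk.induct) auto

lemma walks_between_rev: "p \<in> walks_between V E u v \<Longrightarrow> rev p \<in> walks_between V E v u"
  using walk_rev[of V E p] by (cases "p = []") (auto simp: walks_between_def hd_rev last_rev)

lemma walks_between_join:
  assumes "p \<in> walks_between V E u v" "q \<in> walks_between V E v w"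
  shows "p @ tl q \<in> walks_between V E u w"
    and "walk_length l (p @ tl q) = walk_length l p + walk_length l q"
  using walk_join[of V E p q l] assms by (auto simp: walks_between_def)

lemma walks_between_trans:
  assumes "walks_between V E u v \<noteq> {}" "walks_between V E v w \<noteq> {}"
  shows "walks_between V E u w \<noteq> {}"
  using assms walks_between_join(1)[of _ V E u v _ w] by auto

lemma walks_between_sym: "walks_between V E u v \<noteq> {} \<Longrightarrow> walks_between V E v u \<noteq> {}"
  using walks_between_rev[of _ V E u v] by auto

lemma walks_between_edge:
  assumes "{u, v} \<in> E" "u \<in> V" "v \<in> V" shows "[u, v] \<in> walks_between V E u v"
  using assms by (simp add: walks_between_def)

lemma sp_dist_commute: "sp_dist V E l u v = sp_dist V E l v u"
proof -
  have "walk_length l ` walks_between V E u v \<subseteq> walk_length l ` walks_between V E v u" for u v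
  proof
    fix x assume "x \<in> walk_length l ` walks_between V E u v"
    then obtain p where p: "p \<in> walks_between V E u v" "x = walk_length l p" by auto
    then have "x = walk_length l (rev p)" using walk_rev[of V E p l] by (auto simp: walks_between_def)
    then show "x \<in> walk_length l ` walks_between V E v u" using walks_between_rev[OF p(1)] by blast
  qed
  then show ?thesis unfolding sp_dist_def by (metis subset_antisym)
qed

context
  fixes V :: "'v set" and E :: "'v set set" and l :: "'v set \<Rightarrow> real"
  assumes l: "\<forall>e\<in>E. 0 \<le> l e"
begin

lemma sp_dist_le_walk: "p \<in> walks_between V E u v \<Longrightarrow> sp_dist V E l u v \<le> walk_length l p"
  unfolding sp_dist_def using walk_length_nonneg[OF _ l]
  by (intro cINF_lower bdd_belowI[of _ 0]) (auto simp: walks_between_def)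

lemma sp_dist_nonneg: "walks_between V E u v \<noteq> {} \<Longrightarrow> 0 \<le> sp_dist V E l u v"
  unfolding sp_dist_def using walk_length_nonneg[OF _ l]
  by (intro cINF_greatest) (auto simp: walks_between_def)

lemma sp_dist_self: "u \<in> V \<Longrightarrow> sp_dist V E l u u = 0"
proof -
  assume "u \<in> V"
  then have "[u] \<in> walks_between V E u u" by (simp add: walks_between_def)
  then show ?thesis using sp_dist_le_walk[of "[u]" u u] sp_dist_nonneg[of u u] by auto
qed

lemma sp_dist_triangle:
  assumes "walks_between V E u v \<noteq> {}" "walks_between V E v w \<noteq> {}"
  shows "sp_dist V E l u w \<le> sp_dist V E l u v + sp_dist V E l v w"
proof -
  have "sp_dist V E l u w - walk_length l q \<le> walk_length l p"
    if "p \<in> walks_between V E u v" "q \<in> walks_between V E v w" for p q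
    using sp_dist_le_walk[OF walks_between_join(1)[OF that]] walks_between_join(2)[OF that, of l] by simp
  then have "sp_dist V E l u w - walk_length l q \<le> sp_dist V E l u v" if "q \<in> walks_between V E v w" for q
    unfolding sp_dist_def[of V E l u v] using that assms(1) by (intro cINF_greatest)
  then have "sp_dist V E l u w - sp_dist V E l u v \<le> walk_length l q" if "q \<in> walks_between V E v w" for q
    using that by (simp add: algebra_simps)
  then have "sp_dist V E l u w - sp_dist V E l u v \<le> sp_dist V E l v w"
    unfolding sp_dist_def[of V E l v w] using assms(2) by (intro cINF_greatest)
  then show ?thesis by simp
qed

end

subsection \<open>From labellings to solutions\<close>

text \<open>Vertices with equal labels have distance 0, so representatives carry \<delta> over to
  the parts. Labels may separate vertices at distance 0, as coinciding terminals require.\<close>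

lemma solution_from_labelling:
  fixes label :: "'v \<Rightarrow> 'k" and \<delta> :: "'v \<Rightarrow> 'v \<Rightarrow> real"
  assumes V: "finite V" "T \<subseteq> V" and \<delta>: "semimetric_on V \<delta>"
    and label: "\<And>u v. u \<in> V \<Longrightarrow> v \<in> V \<Longrightarrow> label u = label v \<Longrightarrow> \<delta> u v = 0" "inj_on label T"
    and T: "\<And>t t'. t \<in> T \<Longrightarrow> t' \<in> T \<Longrightarrow> \<delta> t t' = sp_dist V E l t t'"
  shows "\<exists>F \<delta>'. zero_ext_solution V E l T F \<delta>' \<and> card F \<le> card (label ` V) \<and>
    (\<forall>u\<in>V. \<forall>v\<in>V. \<delta>' (part_of F u) (part_of F v) = \<delta> u v)"
proof -
  define part where "part x = {v \<in> V. label v = x}" for x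
  define F where "F = part ` label ` V"
  define rep where "rep A = (SOME v. v \<in> A)" for A :: "'v set"
  define \<delta>' where "\<delta>' A B = \<delta> (rep A) (rep B)" for A B
  have part_of: "part_of F u = part (label u)" if "u \<in> V" for u
    unfolding part_of_def by (rule the_equality) (use that in \<open>auto simp: F_def part_def\<close>)
  have rep: "rep (part (label u)) \<in> V" "label (rep (part (label u))) = label u" if "u \<in> V" for u
    using someI[of "\<lambda>v. v \<in> part (label u)" u] that by (auto simp: rep_def part_def)
  have zero: "\<delta> u (rep (part (label u))) = 0" "\<delta> (rep (part (label u))) u = 0" if "u \<in> V" for u
    using label(1) rep[OF that] that by auto
  have \<delta>'_eq: "\<delta>' (part_of F u) (part_of F v) = \<delta> u v" if uv: "u \<in> V" "v \<in> V" for u v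
  proof -
    let ?u = "rep (part (label u))" and ?v = "rep (part (label v))"
    have "\<delta> u v \<le> \<delta> u ?u + (\<delta> ?u ?v + \<delta> ?v v)" "\<delta> ?u ?v \<le> \<delta> ?u u + (\<delta> u v + \<delta> v ?v)"
      using semimetric_onD(4)[OF \<delta>] uv rep by (meson add_left_mono order_trans)+
    then show ?thesis using zero uv by (simp add: \<delta>'_def part_of)
  qed
  have "partition_on V F"
    by (rule partition_onI) (auto simp: F_def part_def disjnt_def)
  moreover have "part_of F t \<noteq> part_of F t'" if "t \<in> T" "t' \<in> T" "t \<noteq> t'" for t t'
    using that V(2) inj_onD[OF label(2), of t t'] part_of[of t] part_of[of t'] by (auto simp: part_def)
  moreover have "semimetric_on F \<delta>'"
  proof -
    have "rep A \<in> V" if "A \<in> F" for A using that rep by (auto simp: F_def)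
    then show ?thesis using \<delta> unfolding semimetric_on_def \<delta>'_def by blast
  qed
  moreover have "\<delta>' (part_of F t) (part_of F t') = sp_dist V E l t t'" if "t \<in> T" "t' \<in> T" for t t'
    using \<delta>'_eq[of t t'] T[OF that] that V(2) by auto
  ultimately have "zero_ext_solution V E l T F \<delta>'" unfolding zero_ext_solution_def by blast
  moreover have "card F \<le> card (label ` V)" unfolding F_def using V(1) by (intro card_image_le) simp
  ultimately show ?thesis using \<delta>'_eq by blast
qed

section \<open>Mapping the graph into the tight span of its terminals\<close>

theorem theorem3p2:
  fixes V T :: "'v set" and E :: "'v set set" and c l :: "'v set \<Rightarrow> real"
  assumes "zero_ext_instance V E c l T"
    and "card T \<le> 5"
  shows "\<exists>F \<delta>. zero_ext_solution V E l T F \<delta> \<and> card F \<le> 30 \<and>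
           vol E c F \<delta> \<le> (\<Sum>e \<in> E. c e * on_edge (sp_dist V E l) e)"
proof -
  let ?D = "sp_dist V E l" and ?W = "walks_between V E"
  have finV: "finite V" and E: "E \<subseteq> {{u, v} | u v. u \<in> V \<and> v \<in> V \<and> u \<noteq> v}"
    and c: "\<And>e. e \<in> E \<Longrightarrow> 0 \<le> c e" and l: "\<forall>e\<in>E. 0 \<le> l e"
    and TV: "T \<subseteq> V" and conn: "\<And>t t'. t \<in> T \<Longrightarrow> t' \<in> T \<Longrightarrow> ?W t t' \<noteq> {}"
    using assms(1) by (auto simp: zero_ext_instance_def less_imp_le)
  have finE: "finite E"
    using finV E by (intro finite_subset[of E "Pow V"]) auto
  have "\<exists>uv. e = {fst uv, snd uv} \<and> fst uv \<in> V \<and> snd uv \<in> V" if "e \<in> E" for e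
  proof -
    obtain u v where "e = {u, v}" "u \<in> V" "v \<in> V" using E \<open>e \<in> E\<close> by blast
    then show ?thesis by (intro exI[of _ "(u, v)"]) simp
  qed
  then obtain ends where *: "\<forall>e\<in>E. e = {fst (ends e), snd (ends e)} \<and> fst (ends e) \<in> V \<and> snd (ends e) \<in> V"
    using bchoice[of E "\<lambda>e uv. e = {fst uv, snd uv} \<and> fst uv \<in> V \<and> snd uv \<in> V"] by blast
  have ends: "e = {fst (ends e), snd (ends e)}" "fst (ends e) \<in> V" "snd (ends e) \<in> V" if "e \<in> E" for e
    using * that by blast+
  have edge: "?W (fst (ends e)) (snd (ends e)) \<noteq> {}" if "e \<in> E" for e
    using walks_between_edge[of "fst (ends e)" "snd (ends e)" E V] ends that by auto
  have D_edge: "on_edge ?D e = ?D (fst (ends e)) (snd (ends e))" if "e \<in> E" for e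
    by (subst ends(1)[OF that], rule on_edge_doubleton, rule sp_dist_commute)
  have conclude: ?thesis
    if \<delta>: "semimetric_on V \<delta>" and label: "\<And>u v. u \<in> V \<Longrightarrow> v \<in> V \<Longrightarrow> label u = label v \<Longrightarrow> \<delta> u v = 0" "inj_on label T"
      and T: "\<And>t t'. t \<in> T \<Longrightarrow> t' \<in> T \<Longrightarrow> \<delta> t t' = ?D t t'"
      and cost: "(\<Sum>e\<in>E. c e * \<delta> (fst (ends e)) (snd (ends e))) \<le> (\<Sum>e \<in> E. c e * on_edge ?D e)"
      and card: "card (label ` V) \<le> 30"
    for \<delta> and label :: "'v \<Rightarrow> 5 + nat set \<times> 5"
  proof -
    have "\<exists>F \<delta>'. zero_ext_solution V E l T F \<delta>' \<and> card F \<le> card (label ` V) \<and>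
        (\<forall>u\<in>V. \<forall>v\<in>V. \<delta>' (part_of F u) (part_of F v) = \<delta> u v)"
      by (rule solution_from_labelling) (use finV TV \<delta> label T in \<open>blast+\<close>)
    then obtain F \<delta>' where F: "zero_ext_solution V E l T F \<delta>'" "card F \<le> card (label ` V)"
      "\<forall>u\<in>V. \<forall>v\<in>V. \<delta>' (part_of F u) (part_of F v) = \<delta> u v"
      by blast
    have "on_edge (\<lambda>u v. \<delta>' (part_of F u) (part_of F v)) e = \<delta> (fst (ends e)) (snd (ends e))" if e: "e \<in> E" for e
    proof -
      have "on_edge (\<lambda>u v. \<delta>' (part_of F u) (part_of F v)) e
          = \<delta>' (part_of F (fst (ends e))) (part_of F (snd (ends e)))"
        by (subst ends(1)[OF e], rule on_edge_doubleton)
          (use F(3) ends(2,3)[OF e] semimetric_onD(3)[OF \<delta>] in auto)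
      then show ?thesis using F(3) ends(2,3)[OF e] by simp
    qed
    then have "vol E c F \<delta>' \<le> (\<Sum>e \<in> E. c e * on_edge ?D e)" using cost by (simp add: vol_def)
    then show ?thesis using F(1,2) card by (meson order_trans)
  qed
  show ?thesis
  proof (cases "T = {}")
    case True
    have "card ((\<lambda>_. Inl 0) ` V :: (5 + nat set \<times> 5) set) \<le> 1"
      using card_mono[of "{Inl 0 :: 5 + nat set \<times> 5}" "(\<lambda>_. Inl 0) ` V"] by auto
    moreover have "0 \<le> (\<Sum>e \<in> E. c e * on_edge ?D e)"
      using c sp_dist_nonneg[OF l edge] by (intro sum_nonneg mult_nonneg_nonneg) (auto simp: D_edge)
    ultimately show ?thesis
      by (intro conclude[of "\<lambda>_ _. 0" "\<lambda>_. Inl 0"]) (auto simp: True semimetric_on_def)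
  next
    case False
    have finT: "finite T" using finV TV finite_subset by blast
    obtain g :: "'v \<Rightarrow> 5" where g: "inj_on g T"
      using card_le_inj[OF finT, of "UNIV :: 5 set"] assms(2) by auto
    obtain t0 where t0: "t0 \<in> T" using False by blast
    \<comment> \<open>Missing terminals are replaced by copies of \<open>t0\<close>; this is one
      reason to admit semimetrics on the five indices.\<close>
    define t where "t i = (if i \<in> g ` T then inv_into T g i else t0)" for i
    have t_in: "t i \<in> T" for i using t0 by (auto simp: t_def inv_into_into)
    have t_g: "t (g v) = v" if "v \<in> T" for v using that g by (simp add: t_def)
    define d where "d i j = ?D (t i) (t j)" for i j
    have d: "semimetric_on UNIV d"
      unfolding semimetric_on_def d_def
    proof (intro conjI ballI)
      fix i j k
      show "0 \<le> ?D (t i) (t j)" by (rule sp_dist_nonneg[OF l conn[OF t_in t_in]])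
      show "?D (t i) (t i) = 0" using sp_dist_self[OF l, of "t i" V] t_in[of i] TV by blast
      show "?D (t i) (t j) = ?D (t j) (t i)" by (rule sp_dist_commute)
      show "?D (t i) (t k) \<le> ?D (t i) (t j) + ?D (t j) (t k)"
        by (rule sp_dist_triangle[OF l conn[OF t_in t_in] conn[OF t_in t_in]])
    qed
    define R where "R = {v \<in> V. ?W v t0 \<noteq> {}}"
    have R_conn: "?W v (t i) \<noteq> {}" if "v \<in> R" for v i
      using that walks_between_trans[OF _ conn[OF t0 t_in], of v i] by (simp add: R_def)
    have edge_R: "fst (ends e) \<in> R \<longleftrightarrow> snd (ends e) \<in> R" if "e \<in> E" for e
      using walks_between_trans[OF edge[OF that], of t0] ends(2,3)[OF that]
        walks_between_trans[OF walks_between_sym[OF edge[OF that]], of t0] by (auto simp: R_def)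
    obtain \<rho> where *: "\<forall>f\<in>dominating d. \<rho> f \<in> tight_span d \<and> (\<forall>i. \<rho> f i \<le> f i) \<and>
        (\<forall>g\<in>dominating d. \<forall>M. (\<forall>j. \<bar>f j - g j\<bar> \<le> M) \<longrightarrow> (\<forall>i. \<bar>\<rho> f i - \<rho> g i\<bar> \<le> M))"
      using tight_span_retraction[OF d] by (rule exE)
    have \<rho>: "\<rho> f \<in> tight_span d" "\<rho> f i \<le> f i" if "f \<in> dominating d" for f i
      using bspec[OF * that] by simp_all
    have \<rho>_lipschitz: "\<bar>\<rho> f i - \<rho> g i\<bar> \<le> M"
      if "f \<in> dominating d" "g \<in> dominating d" "\<And>j. \<bar>f j - g j\<bar> \<le> M" for f g M i
      using bspec[OF * that(1)] that(2,3) by simp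
    define \<phi> where "\<phi> v i = ?D v (t i)" for v i
    have \<phi>: "\<phi> v \<in> dominating d" if "v \<in> R" for v
    proof -
      have "?D (t i) (t j) \<le> ?D v (t i) + ?D v (t j)" for i j
        using sp_dist_triangle[OF l walks_between_sym[OF R_conn[OF that]] R_conn[OF that], of i j]
          sp_dist_commute[of V E l v "t i"] by simp
      then show ?thesis by (simp add: dominating_def d_def \<phi>_def)
    qed
    \<comment> \<open>Vertices in components without terminals all go to one arbitrary row, so edges
      between them cost 0.\<close>
    define \<psi> where "\<psi> v = (if v \<in> R then \<rho> (\<phi> v) else d 0)" for v
    have \<psi>: "\<psi> v \<in> tight_span d" for v
      using \<rho>(1)[OF \<phi>] row_in_tight_span[OF d] by (simp add: \<psi>_def)
    have \<psi>_t: "\<psi> (t i) = d i" for i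
    proof -
      have R: "t i \<in> R" using t_in[of i] TV conn[OF t_in t0] by (auto simp: R_def)
      have "\<phi> (t i) = d i" by (auto simp: \<phi>_def d_def)
      then show ?thesis
        using tight_span_minimal[OF row_in_tight_span[OF d], of "\<rho> (d i)" i] \<rho>(1,2)[OF \<phi>[OF R]] R
        by (simp add: \<psi>_def tight_span_def)
    qed
    have \<psi>_edge: "\<bar>\<psi> (fst (ends e)) i - \<psi> (snd (ends e)) i\<bar> \<le> on_edge ?D e" if e: "e \<in> E" for e i
    proof (cases "fst (ends e) \<in> R")
      case True
      let ?u = "fst (ends e)" and ?v = "snd (ends e)"
      have uv: "?u \<in> R" "?v \<in> R" "?W ?u ?v \<noteq> {}" "?W ?v ?u \<noteq> {}"
        using True edge_R[OF e] edge[OF e] walks_between_sym[OF edge[OF e]] by auto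
      have "\<bar>\<phi> ?u j - \<phi> ?v j\<bar> \<le> on_edge ?D e" for j
        using sp_dist_triangle[OF l uv(3) R_conn[OF uv(2)], of j] sp_dist_triangle[OF l uv(4) R_conn[OF uv(1)], of j]
          sp_dist_commute[of V E l ?u ?v] by (simp add: \<phi>_def D_edge[OF e])
      then show ?thesis using \<rho>_lipschitz[OF \<phi>[OF uv(1)] \<phi>[OF uv(2)]] uv by (simp add: \<psi>_def)
    next
      case False
      then show ?thesis using edge_R[OF e] sp_dist_nonneg[OF l edge[OF e]] by (simp add: \<psi>_def D_edge[OF e])
    qed
    obtain S where "five_point_splits d S" using five_point_splits_exist[OF _ d] by auto
    then interpret five_point_splits d S .
    obtain \<mu> and label :: "(5 \<Rightarrow> real) \<Rightarrow> 5 + nat set \<times> 5" where \<mu>: "semimetric_on UNIV \<mu>"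
        and \<mu>_d: "\<And>s t. \<mu> (d s) (d t) = d s t"
        and cost: "(\<Sum>e\<in>E. c e * \<mu> (\<psi> (fst (ends e))) (\<psi> (snd (ends e)))) \<le> (\<Sum>e\<in>E. c e * on_edge ?D e)"
        and label_l: "\<And>g p. g \<in> tight_span d \<Longrightarrow> label g = Inl p \<Longrightarrow> \<mu> g (d p) = 0"
        and label_r: "\<And>g g' x. g \<in> tight_span d \<Longrightarrow> g' \<in> tight_span d \<Longrightarrow> label g = Inr x \<Longrightarrow> label g' = Inr x \<Longrightarrow> \<mu> g g' = 0"
        and fin: "finite {x. Inr x \<in> label ` tight_span d}" and card: "card {x. Inr x \<in> label ` tight_span d} \<le> 25"
      using rounding[of E c "\<lambda>e. \<psi> (fst (ends e))" "\<lambda>e. \<psi> (snd (ends e))" "on_edge ?D", OF finE c \<psi> \<psi> \<psi>_edge]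
      by blast
    \<comment> \<open>Terminals are labelled by index and not by position, so that terminals at
      distance 0 stay in different parts.\<close>
    define lab where "lab v = (if v \<in> T then Inl (g v) else label (\<psi> v))" for v
    have lab_l: "\<mu> (\<psi> v) (d p) = 0" if "lab v = Inl p" for v p
    proof (cases "v \<in> T")
      case True
      then have "\<psi> v = d p" using \<psi>_t[of "g v"] t_g that by (simp add: lab_def)
      then show ?thesis using semimetric_onD(2)[OF \<mu>] by simp
    next
      case False
      then show ?thesis using that label_l[OF \<psi>] by (simp add: lab_def)
    qed
    show ?thesis
    proof (rule conclude[of "\<lambda>u v. \<mu> (\<psi> u) (\<psi> v)" lab])
      show "semimetric_on V (\<lambda>u v. \<mu> (\<psi> u) (\<psi> v))"
        using \<mu> unfolding semimetric_on_def by simp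
      show "inj_on lab T" using g by (auto simp: inj_on_def lab_def)
      show "\<mu> (\<psi> s) (\<psi> s') = ?D s s'" if "s \<in> T" "s' \<in> T" for s s'
        using \<mu>_d[of "g s" "g s'"] \<psi>_t[of "g s"] \<psi>_t[of "g s'"] t_g that by (simp add: d_def)
      show "\<mu> (\<psi> u) (\<psi> v) = 0" if "lab u = lab v" for u v
      proof (cases "lab u")
        case (Inl p)
        then show ?thesis
          using semimetric_onD(4)[OF \<mu>, of "\<psi> u" "d p" "\<psi> v"] lab_l[of u p] lab_l[of v p] that
            semimetric_onD(1,3)[OF \<mu>, of "\<psi> u" "\<psi> v"] semimetric_onD(3)[OF \<mu>, of "\<psi> v" "d p"] by simp
      next
        case (Inr x)
        have "label (\<psi> w) = Inr x" if "lab w = Inr x" for w using that by (simp add: lab_def split: if_splits)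
        then show ?thesis using label_r[OF \<psi> \<psi>, of u x v] Inr that by simp
      qed
      show "(\<Sum>e\<in>E. c e * \<mu> (\<psi> (fst (ends e))) (\<psi> (snd (ends e)))) \<le> (\<Sum>e \<in> E. c e * on_edge ?D e)"
        by (rule cost)
      let ?L = "range Inl \<union> Inr ` {x. Inr x \<in> label ` tight_span d} :: (5 + nat set \<times> 5) set"
      have "lab v \<in> ?L" for v
        using \<psi>[of v] by (cases "lab v") (force simp: lab_def split: if_splits)+
      then have "card (lab ` V) \<le> card ?L" using fin by (intro card_mono) auto
      also have "\<dots> \<le> card (range Inl :: (5 + nat set \<times> 5) set) + card (Inr ` {x. Inr x \<in> label ` tight_span d} :: (5 + nat set \<times> 5) set)"
        by (rule card_Un_le)
      also have "\<dots> \<le> 5 + 25"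
        using card by (intro add_mono) (simp_all add: card_image)
      finally show "card (lab ` V) \<le> 30" by simp
    qed
  qed
qed

end
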